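(* Let $f\colon\Lambda\to\Lambda$ be a Smale horseshoe map. Then there is an uncountable collection $\mathcal{N}$ of Borel measurable subsets of $\Lambda$ satisfying: (1) there is a continuous function $\varphi\colon\Lambda\to\mathbb{R}$ such that every $N\in\mathcal{N}$ is contained in $\hat{\Lambda}(\varphi)$; (2) every $N\in\mathcal{N}$ is dense in $\Lambda$ and satisfies $f(N)\subset N$; (3) for every distinct $N,N'\in\mathcal{N}$ we have $N\cap N'=\emptyset$; (4) for every $N\in\mathcal{N}$ we have $h(f|N)=h_{top}(f)$.
   Context: Smale horseshoe map: $\Lambda$ is the compact maximal invariant set of the standard Smale horseshoe and $f$ is the restriction of the horseshoe diffeomorphism to $\Lambda$; $f\colon\Lambda\to\Lambda$ is topologically conjugate to the two-sided full shift on two symbols. Irregular set: for continuous $\varphi\colon \Lambda\to\mathbb{R}$, $\hat{\Lambda}(\varphi)$ is the set of $x\in \Lambda$ for which $\lim_{n\to\infty}\frac1n\sum_{j=0}^{n-1}\varphi(f^j(x))$ does not exist. Topological entropy of a (not necessarily compact or invariant) subset: let $f\colon X\to X$ be a continuous map of a compact metric space and $Z\subset X$. For a finite open cover $\mathcal{U}$ of $X$, a string $\mathbf{U}=U_{0}\cdots U_{m-1}$ of elements of $\mathcal{U}$ has length $m(\mathbf{U})=m$, and $X(\mathbf{U})=\{x\in X: f^j(x)\in U_j,\ 0\le j\le m-1\}$. For $\alpha\in\mathbb{R}$ put $m_{\mathcal{U}}(Z,\alpha)=\lim_{n\to\infty}\inf\{\sum_{\mathbf{U}\in\mathcal{G}}e^{-\alpha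 m(\mathbf{U})}\}$, the infimum over finite or countable collections $\mathcal{G}$ of strings with $m(\mathbf{U})\ge n$ for all $\mathbf{U}\in\mathcal{G}$ and $Z\subset\bigcup_{\mathbf{U}\in\mathcal{G}}X(\mathbf{U})$. Let $h_{\mathcal{U}}(f|Z)=\inf\{\alpha: m_{\mathcal{U}}(Z,\alpha)=0\}$ and $h(f|Z)=\lim_{\operatorname{diam}(\mathcal{U})\to0}h_{\mathcal{U}}(f|Z)$ (this limit exists). $h_{top}(f)$ denotes the usual topological entropy, which equals $h(f|X)$. *)

theory Defs
  imports "HOL-Analysis.Analysis"
begin

section \<open>Smale horseshoe maps\<close>

abbreviation unit_square :: "(real \<times> real) set"
  where "unit_square \<equiv> {0..1} \<times> {0..1}"

text \<open>
  By the inverse function theorem, for open \<open>U\<close> this says that \<open>F\<close> is a \<open>C\<^sup>1\<close> diffeomorphism of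
  \<open>U\<close> onto an open subset of the plane.
\<close>

definition C1_embedding_on :: "(real \<times> real) set \<Rightarrow> (real \<times> real \<Rightarrow> real \<times> real) \<Rightarrow> bool"
  where "C1_embedding_on U F \<longleftrightarrow>
    inj_on F U \<and>
    (\<exists>F' :: real \<times> real \<Rightarrow> (real \<times> real) \<Rightarrow>\<^sub>L (real \<times> real).
       continuous_on U F' \<and>
       (\<forall>z\<in>U. (F has_derivative blinfun_apply (F' z)) (at z) \<and> bij (blinfun_apply (F' z))))"

text \<open>
  The map \<open>F\<close> sends the horizontal strip \<open>[0,1] \<times> I\<close> onto the vertical strip \<open>J \<times> [0,1]\<close> by a
  hyperbolic affine map which contracts the horizontal and expands the vertical direction. The
  signs of \<open>l\<close> and \<open>m\<close> are free: in the usual picture the linear part is \<open>diag(l,m)\<close> on one strip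
  and \<open>diag(-l,-m)\<close> on the folded one.
\<close>

definition affine_hyperbolic_strip ::
    "(real \<times> real \<Rightarrow> real \<times> real) \<Rightarrow> real set \<Rightarrow> real set \<Rightarrow> bool"
  where "affine_hyperbolic_strip F I J \<longleftrightarrow>
    F ` ({0..1} \<times> I) = J \<times> {0..1} \<and>
    (\<exists>l m p q. 0 < \<bar>l\<bar> \<and> \<bar>l\<bar> < 1 \<and> 1 < \<bar>m\<bar> \<and>
       (\<forall>x\<in>{0..1}. \<forall>y\<in>I. F (x, y) = (p + l * x, q + m * y)))"

text \<open>
  The diffeomorphism is only required to be given near the unit square \<open>Q\<close>, so that horseshoes
  on the plane and on the sphere (in a chart) are both covered. The image \<open>F ` Q\<close> meets \<open>Q\<close> in
  exactly two disjoint vertical strips, the images of two horizontal strips of \<open>Q\<close> on which \<open>F\<close>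
  is affine; nothing is prescribed about the rest of \<open>Q\<close>, which is mapped outside \<open>Q\<close>.
\<close>

definition smale_horseshoe :: "(real \<times> real \<Rightarrow> real \<times> real) \<Rightarrow> bool"
  where "smale_horseshoe F \<longleftrightarrow>
    (\<exists>U. open U \<and> unit_square \<subseteq> U \<and> C1_embedding_on U F) \<and>
    (\<exists>a0 b0 a1 b1 c0 d0 c1 d1.
       a0 < b0 \<and> a1 < b1 \<and> c0 < d0 \<and> c1 < d1 \<and>
       {a0..b0} \<subseteq> {0..1} \<and> {a1..b1} \<subseteq> {0..1} \<and>
       {c0..d0} \<inter> {c1..d1} = {} \<and>
       affine_hyperbolic_strip F {a0..b0} {c0..d0} \<and>
       affine_hyperbolic_strip F {a1..b1} {c1..d1} \<and>
       unit_square \<inter> F ` unit_square = {c0..d0} \<times> {0..1} \<union> {c1..d1} \<times> {0..1})"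

text \<open>
  For injective \<open>F\<close> this is the set of points of \<open>Q\<close> whose full two-sided orbit is defined and
  stays in \<open>Q\<close>, that is, the intersection of all \<open>F\<^sup>n(Q)\<close> with \<open>n\<close> an integer.
\<close>

definition maximal_invariant_set :: "('a \<Rightarrow> 'a) \<Rightarrow> 'a set \<Rightarrow> 'a set"
  where "maximal_invariant_set F Q = \<Union>{A. A \<subseteq> Q \<and> F ` A = A}"


section \<open>Irregular sets\<close>

definition irregular_set :: "('a \<Rightarrow> 'a) \<Rightarrow> 'a set \<Rightarrow> ('a \<Rightarrow> real) \<Rightarrow> 'a set"
  where "irregular_set f X \<phi> =
    {x \<in> X. \<not> convergent (\<lambda>n. (\<Sum>j<n. \<phi> ((f ^^ j) x)) / real n)}"


section \<open>Topological entropy\<close>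

text \<open>
  Below, \<open>X\<close> is the phase space, carrying the subspace topology, and \<open>f\<close> maps \<open>X\<close> to itself; the
  values of \<open>f\<close> outside \<open>X\<close> play no role. A string is a list of elements of a cover.
\<close>

definition open_cover :: "'a::topological_space set \<Rightarrow> 'a set set \<Rightarrow> bool"
  where "open_cover X \<U> \<longleftrightarrow> (\<forall>U\<in>\<U>. openin (top_of_set X) U) \<and> \<Union>\<U> = X"

definition string_set :: "('a \<Rightarrow> 'a) \<Rightarrow> 'a set \<Rightarrow> 'a set list \<Rightarrow> 'a set"
  where "string_set f X Us = {x \<in> X. \<forall>j<length Us. (f ^^ j) x \<in> Us ! j}"

definition string_covers ::
    "('a \<Rightarrow> 'a) \<Rightarrow> 'a set \<Rightarrow> 'a set set \<Rightarrow> 'a set \<Rightarrow> nat \<Rightarrow> 'a set list set set"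
  where "string_covers f X \<U> Z n =
    {\<G>. \<G> \<subseteq> lists \<U> \<and> countable \<G> \<and> (\<forall>Us\<in>\<G>. n \<le> length Us) \<and>
         Z \<subseteq> (\<Union>Us\<in>\<G>. string_set f X Us)}"

definition cover_measure ::
    "('a \<Rightarrow> 'a) \<Rightarrow> 'a set \<Rightarrow> 'a set set \<Rightarrow> 'a set \<Rightarrow> real \<Rightarrow> ennreal"
  where "cover_measure f X \<U> Z \<alpha> =
    lim (\<lambda>n. INF \<G>\<in>string_covers f X \<U> Z n.
                \<Sum>\<^sub>\<infinity>Us\<in>\<G>. ennreal (exp (- \<alpha> * real (length Us))))"

definition cover_entropy :: "('a \<Rightarrow> 'a) \<Rightarrow> 'a set \<Rightarrow> 'a set set \<Rightarrow> 'a set \<Rightarrow> ereal"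
  where "cover_entropy f X \<U> Z = Inf (ereal ` {\<alpha>. cover_measure f X \<U> Z \<alpha> = 0})"

text \<open>The filter on finite open covers of \<open>X\<close> that describes \<open>diam \<U> \<rightarrow> 0\<close>.\<close>

definition fine_covers :: "'a::metric_space set \<Rightarrow> 'a set set filter"
  where "fine_covers X =
    (INF e\<in>{0<..}. principal {\<U>. finite \<U> \<and> open_cover X \<U> \<and> (\<forall>U\<in>\<U>. diameter U < e)})"

definition subset_entropy :: "('a::metric_space \<Rightarrow> 'a) \<Rightarrow> 'a set \<Rightarrow> 'a set \<Rightarrow> ereal"
  where "subset_entropy f X Z = Lim (fine_covers X) (\<lambda>\<U>. cover_entropy f X \<U> Z)"

text \<open>
  The usual topological entropy of \<open>f\<close> on compact \<open>X\<close>, in the definition of Adler, Konheim and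
  McAndrew.
\<close>

definition min_subcover_card :: "'a set \<Rightarrow> 'a set set \<Rightarrow> nat"
  where "min_subcover_card X \<U> = Inf (card ` {\<V>. \<V> \<subseteq> \<U> \<and> finite \<V> \<and> \<Union>\<V> = X})"

text \<open>The common refinement of the covers \<open>f\<^sup>-\<^sup>j \<U>\<close> for \<open>j < n\<close>.\<close>

definition iterated_join :: "('a \<Rightarrow> 'a) \<Rightarrow> 'a set \<Rightarrow> 'a set set \<Rightarrow> nat \<Rightarrow> 'a set set"
  where "iterated_join f X \<U> n = string_set f X ` {Us \<in> lists \<U>. length Us = n}"

definition topological_entropy :: "('a::topological_space \<Rightarrow> 'a) \<Rightarrow> 'a set \<Rightarrow> ereal"
  where "topological_entropy f X =
    (SUP \<U>\<in>{\<U>. open_cover X \<U>}.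
       lim (\<lambda>n. ereal (ln (real (min_subcover_card X (iterated_join f X \<U> n))) / real n)))"

end

(*
  The coding of the horseshoe by the two-sided full 2-shift gives all that is needed, in a one-sided
  form: every 0-1 sequence is the forward itinerary of some point of the invariant set, and points
  whose itineraries agree for a long time have close images in the middle of that time.

  With a spin +1 or -1 for each symbol, let S_n be its Birkhoff sums. For a sequence e of signs, N_e
  consists of the points for which e_n * S_m >= eps * m for some eps > 0 and all large n, where
  m = (n + 1)!. This is a tail condition, so N_e is forward invariant and dense; if e takes both
  signs infinitely often, then the averages of its points diverge; and N_e, N_e' are disjoint if
  e, e' differ infinitely often, which happens for any two members of a suitable uncountable family.

  N_e contains the points all of whose blocks of odd length k have a prescribed majority. Exactly
  half of the k-words have a given majority, so these points have entropy (1 - 1/k) ln 2.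
*)

theory Submission
  imports Defs
begin

section \<open>Words and growth rates\<close>

text \<open>Two obstacles shape the proof. The map is invertible on the invariant set, so a forward
  itinerary does not determine a point. As the map is onto, a point is written as a k-th image, and
  the first k symbols of the preimage stand in for its past. The sets N_e are neither closed nor
  carriers of a convenient measure that would bound their entropy from below. Their subsets with
  prescribed block majorities are compact, which cuts countable covers by strings down to finite
  ones, and the blocks can be chosen independently, so that counting sample points replaces a
  measure. Since each k loses (ln 2) / k, such a subset has to lie in N_e for every odd k; this is
  why eps may depend on the point. On the side of the horseshoe, the delicate part is the existence
  of points with a given itinerary. They come from an explicit product set that is mapped onto
  itself, so that maximality places it in the invariant set.\<close>

lemma convergent_subadditive_div:
  fixes a :: "nat \<Rightarrow> real"
  assumes subadd: "\<And>m n. a (m + n) \<le> a m + a n" and nonneg: "\<And>n. 0 \<le> a n"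
  shows "convergent (\<lambda>n. a n / real n)"
proof -
  \<comment> \<open>Fekete's lemma: the limit is the infimum of the quotients, which is finite
    because \<open>a\<close> is nonnegative.\<close>
  define L where "L = (INF n\<in>{1..}. a n / real n)"
  have bdd: "bdd_below ((\<lambda>n. a n / real n) ` {1..})"
    by (rule bdd_belowI[of _ 0]) (auto simp: nonneg)
  have lower: "L \<le> a n / real n" if "n \<ge> 1" for n
    unfolding L_def using that by (intro cINF_lower[OF bdd]) auto
  have mult: "a (q * k) \<le> real q * a k" if "q \<ge> 1" for q k
    using that
  proof (induction q rule: nat_induct_at_least)
    case (Suc q)
    have "a (Suc q * k) \<le> a k + a (q * k)" using subadd[of k "q * k"] by simp
    also have "\<dots> \<le> a k + real q * a k" using Suc by simp
    finally show ?case by (simp add: algebra_simps)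
  qed simp
  have "(\<lambda>n. a n / real n) \<longlonglongrightarrow> L"
  proof (rule LIMSEQ_I)
    fix e :: real assume e: "0 < e"
    have "\<exists>x\<in>(\<lambda>n. a n / real n) ` {1..}. x < L + e / 2"
    proof (rule ccontr)
      assume "\<not> ?thesis"
      then have "L + e / 2 \<le> L"
        unfolding L_def by (intro cINF_greatest) (auto simp: not_less)
      with e show False by simp
    qed
    then obtain k where k: "k \<ge> 1" "a k / real k < L + e / 2" by auto
    \<comment> \<open>A bound independent of \<open>n\<close> for the remainder term
      \<open>a (n mod k)\<close> and for the case \<open>n < k\<close>, where \<open>a 0\<close>
      remains.\<close>
    define C where "C = a 0 + a k + (\<Sum>r<k. a r)"
    obtain n0 :: nat where n0: "real n0 > 2 * C / e" using reals_Archimedean2 by blast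
    have "norm (a n / real n - L) < e" if "n \<ge> max 1 n0" for n
    proof -
      have n: "n \<ge> 1" "real n > 2 * C / e" using that n0 by auto
      have "a (n mod k) \<le> (\<Sum>r<k. a r)"
        by (rule member_le_sum) (use k nonneg in auto)
      moreover have "a (n div k * k) \<le> real (n div k) * a k + a 0"
        using mult[of "n div k" k] nonneg[of 0] by (cases "n div k = 0") (auto simp: Suc_le_eq)
      moreover have "a n \<le> a (n div k * k) + a (n mod k)"
        using subadd[of "n div k * k" "n mod k"] by simp
      ultimately have "a n \<le> real (n div k) * a k + C"
        using nonneg[of k] unfolding C_def by linarith
      also have "\<dots> \<le> real n / real k * a k + C"
        using nonneg[of k] by (intro add_right_mono mult_right_mono) (simp_all add: of_nat_div_le_of_nat)
      finally have "a n / real n \<le> (real n / real k * a k + C) / real n"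
        by (intro divide_right_mono) auto
      also have "\<dots> = a k / real k + C / real n"
        using n by (simp add: field_simps)
      also have "C / real n < e / 2" using n e by (simp add: field_simps)
      finally have "a n / real n < L + e" using k by linarith
      with lower[of n] n show ?thesis by auto
    qed
    then show "\<exists>no. \<forall>n\<ge>no. norm (a n / real n - L) < e" by blast
  qed
  then show ?thesis by (rule convergentI)
qed

section \<open>Words with a majority symbol\<close>

definition spin :: "bool \<Rightarrow> int"
  where "spin b = (if b then 1 else -1)"

lemma spin_simps [simp]: "spin True = 1" "spin False = -1"
  by (simp_all add: spin_def)

definition majority_words :: "nat \<Rightarrow> bool \<Rightarrow> bool list set"
  where "majority_words k b = {w. length w = k \<and> 0 < spin b * sum_list (map spin w)}"

lemma finite_majority_words [simp]: "finite (majority_words k b)"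
  by (rule finite_subset[OF _ finite_lists_length_eq[of UNIV k]]) (auto simp: majority_words_def)

lemma even_sum_list_spin: "even (sum_list (map spin w)) \<longleftrightarrow> even (length w)"
  by (induction w) (auto simp: spin_def)

lemma sum_list_spin_Not: "(\<Sum>x\<leftarrow>w. spin (\<not> x)) = - sum_list (map spin w)"
  by (induction w) (auto simp: spin_def)

lemma replicate_in_majority_words: "0 < k \<Longrightarrow> replicate k b \<in> majority_words k b"
  by (auto simp: majority_words_def spin_def sum_list_replicate)

text \<open>Odd length excludes ties because the spin sum has the parity of the length, and flipping
  every symbol exchanges the two majorities. Each of them thus takes half of
  \<open>2 ^ (2 * r + 1)\<close>.\<close>

lemma card_majority_words: "card (majority_words (2 * r + 1) b) = 4 ^ r"
proof -
  let ?k = "2 * r + 1"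
  have "bij_betw (map Not) (majority_words ?k True) (majority_words ?k False)"
    by (rule bij_betw_byWitness[of _ "map Not"])
      (auto simp: majority_words_def sum_list_spin_Not comp_def)
  then have eq: "card (majority_words ?k True) = card (majority_words ?k False)"
    by (rule bij_betw_same_card)
  have neq: "sum_list (map spin w) \<noteq> 0" if "length w = ?k" for w
    using even_sum_list_spin[of w] that by auto
  have "{w :: bool list. set w \<subseteq> UNIV \<and> length w = ?k} = majority_words ?k True \<union> majority_words ?k False"
    using neq by (auto simp: majority_words_def not_less order.order_iff_strict)
  moreover have "majority_words ?k True \<inter> majority_words ?k False = {}"
    by (auto simp: majority_words_def)
  ultimately have "2 ^ ?k = card (majority_words ?k True) + card (majority_words ?k False)"
    using card_lists_length_eq[of "UNIV :: bool set" ?k]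
      card_Un_disjoint[of "majority_words ?k True" "majority_words ?k False"] by simp
  also have "(2::nat) ^ ?k = 2 * 4 ^ r" by (simp add: power_mult)
  finally show ?thesis using eq by (cases b) auto
qed

text \<open>Restriction to the coordinates from \<open>q\<close> on is injective on
  \<open>C\<close>. With blocks as coordinates, this bounds how many block sequences a string can
  cover once it fixes the first \<open>q\<close> blocks.\<close>

lemma card_PiE_agree_le:
  fixes A :: "nat \<Rightarrow> 'b set"
  assumes C: "C \<subseteq> Pi\<^sub>E {..<J} A" and agree: "\<And>c d i. c \<in> C \<Longrightarrow> d \<in> C \<Longrightarrow> i < q \<Longrightarrow> c i = d i"
    and A: "\<And>i. finite (A i)" "\<And>i. card (A i) = K" and "q \<le> J"
  shows "card C \<le> K ^ (J - q)"
proof -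
  have "inj_on (\<lambda>c. restrict c {q..<J}) C"
  proof (rule inj_onI)
    fix c d assume c: "c \<in> C" and d: "d \<in> C" and eq: "restrict c {q..<J} = restrict d {q..<J}"
    show "c = d"
    proof
      fix i
      consider "i < q" | "i \<in> {q..<J}" | "i \<ge> J" by fastforce
      then show "c i = d i"
      proof cases
        case 1 then show ?thesis using agree c d by blast
      next
        case 2 then show ?thesis using fun_cong[OF eq, of i] by simp
      next
        case 3
        then have "i \<notin> {..<J}" by simp
        with C c d show ?thesis by (metis PiE_arb subsetD)
      qed
    qed
  qed
  moreover have "(\<lambda>c. restrict c {q..<J}) ` C \<subseteq> Pi\<^sub>E {q..<J} A"
    using C by fastforce
  ultimately have "card C \<le> card (Pi\<^sub>E {q..<J} A)"
    by (intro card_inj_on_le[OF _ _ finite_PiE]) (auto simp: A)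
  also have "\<dots> = K ^ (J - q)" by (simp add: card_PiE A)
  finally show ?thesis .
qed

section \<open>An index set of sign sequences\<close>

lemma uncountable_frequently_different:
  "\<exists>E :: (nat \<Rightarrow> bool) set. uncountable E \<and>
     (\<forall>e\<in>E. (\<exists>\<^sub>F n in sequentially. e n) \<and> (\<exists>\<^sub>F n in sequentially. \<not> e n)) \<and>
     (\<forall>e\<in>E. \<forall>e'\<in>E. e \<noteq> e' \<longrightarrow> (\<exists>\<^sub>F n in sequentially. e n \<noteq> e' n))"
proof -
  \<comment> \<open>Even times list the bits of \<open>b\<close>, each infinitely often through
    \<open>prod_decode\<close>, so one differing bit yields infinitely many differing times. Odd
    times alternate between True and False, which makes both values recur for every
    \<open>b\<close>.\<close>
  define s :: "(nat \<Rightarrow> bool) \<Rightarrow> nat \<Rightarrow> bool" where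
    "s b n = (if even n then b (fst (prod_decode (n div 2))) else n mod 4 = 1)" for b n
  have differ: "\<exists>\<^sub>F n in sequentially. s b n \<noteq> s b' n" if "b i \<noteq> b' i" for b b' i
  proof (unfold frequently_sequentially, intro allI exI conjI)
    fix m :: nat
    show "m \<le> 2 * prod_encode (i, m)" using le_prod_encode_2[of m i] by linarith
    show "s b (2 * prod_encode (i, m)) \<noteq> s b' (2 * prod_encode (i, m))"
      using that by (simp add: s_def)
  qed
  have "inj s"
  proof (rule injI)
    fix b b' assume "s b = s b'"
    then show "b = b'" using differ[of b _ b'] by (fastforce simp: fun_eq_iff)
  qed
  moreover have "uncountable (UNIV :: (nat \<Rightarrow> bool) set)"
  proof
    assume "countable (UNIV :: (nat \<Rightarrow> bool) set)"
    then obtain g :: "nat \<Rightarrow> (nat \<Rightarrow> bool)" where "range g = UNIV"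
      by (metis UNIV_not_empty range_from_nat_into)
    then obtain n where "g n = (\<lambda>i. \<not> g i i)" by (metis UNIV_I imageE)
    then have "g n n = (\<not> g n n)" by (rule fun_cong)
    then show False by simp
  qed
  ultimately have "uncountable (range s)" using countable_image_inj_on by blast
  moreover have "\<exists>\<^sub>F n in sequentially. s b n" for b
    unfolding frequently_sequentially
  proof (intro allI exI conjI)
    fix m show "m \<le> 4 * m + 1" "s b (4 * m + 1)" by (auto simp: s_def)
  qed
  moreover have "\<exists>\<^sub>F n in sequentially. \<not> s b n" for b
    unfolding frequently_sequentially
  proof (intro allI exI conjI)
    fix m :: nat
    show "m \<le> 4 * m + 3" by simp
    show "\<not> s b (4 * m + 3)" unfolding s_def using mod_mult_self4[of 4 m 3] by simp
  qed
  moreover have "\<exists>\<^sub>F n in sequentially. s b n \<noteq> s b' n" if "s b \<noteq> s b'" for b b'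
  proof -
    from that have "b \<noteq> b'" by blast
    then obtain i where "b i \<noteq> b' i" by blast
    then show ?thesis by (rule differ)
  qed
  ultimately show ?thesis by (intro exI[of _ "range s"]) auto
qed

section \<open>Entropy of systems with a binary coding\<close>

lemma funpow_funpow: "(f ^^ m) ((f ^^ n) x) = (f ^^ (m + n)) x"
  by (simp add: funpow_add)

text \<open>\<open>expansive\<close> looks at the middle of a window of \<open>2 * k + 1\<close>
  symbols: forward symbols alone leave the contracted direction free, and the first \<open>k\<close>
  symbols are what controls it. As \<open>f\<close> is onto, every point occurs as such a middle
  point.\<close>

locale binary_coding =
  fixes X :: "'a::metric_space set" and f :: "'a \<Rightarrow> 'a" and sym :: "'a \<Rightarrow> bool"
  assumes compact_X: "compact X"
    and continuous_f: "continuous_on X f"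
    and image_f: "f ` X = X"
    and openin_sym: "openin (top_of_set X) {x \<in> X. sym x = b}"
    and expansive: "0 < e \<Longrightarrow> \<exists>k. \<forall>x\<in>X. \<forall>y\<in>X.
          (\<forall>i\<le>2 * k. sym ((f ^^ i) x) = sym ((f ^^ i) y)) \<longrightarrow> dist ((f ^^ k) x) ((f ^^ k) y) < e"
    and realize: "\<exists>x\<in>X. \<forall>i. sym ((f ^^ i) x) = a i"
begin

section \<open>Iterates, cylinders and covering strings\<close>

lemma funpow_mem: "x \<in> X \<Longrightarrow> (f ^^ n) x \<in> X"
  using image_f by (induction n) auto

lemma funpow_image: "(f ^^ n) ` X = X"
proof (induction n)
  case (Suc n)
  have "(f ^^ Suc n) ` X = f ` (f ^^ n) ` X" by (simp add: image_image)
  with Suc show ?case by (simp add: image_f)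
qed simp

lemma continuous_funpow: "continuous_on X (f ^^ n)"
proof (induction n)
  case (Suc n)
  then show ?case
    using continuous_on_compose[OF Suc] continuous_f by (simp add: funpow_image comp_def)
qed (simp add: id_def)

lemma openin_preimage_funpow:
  "openin (top_of_set X) U \<Longrightarrow> openin (top_of_set X) {x \<in> X. (f ^^ n) x \<in> U}"
  using continuous_openin_preimage[OF continuous_funpow[of n], of X U] funpow_mem
  by (auto simp: vimage_def Int_def Pi_iff)

lemma openin_sym_funpow: "openin (top_of_set X) {x \<in> X. sym ((f ^^ i) x) = b}"
proof -
  have "{x \<in> X. sym ((f ^^ i) x) = b} = {x \<in> X. (f ^^ i) x \<in> {x \<in> X. sym x = b}}"
    using funpow_mem by auto
  then show ?thesis using openin_preimage_funpow[OF openin_sym] by simp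
qed

lemma openin_Ball_lessThan:
  fixes n :: nat
  assumes "\<And>j. j < n \<Longrightarrow> openin (top_of_set X) {x \<in> X. P j x}"
  shows "openin (top_of_set X) {x \<in> X. \<forall>j<n. P j x}"
  using assms
proof (induction n)
  case (Suc n)
  have "{x \<in> X. \<forall>j<Suc n. P j x} = {x \<in> X. \<forall>j<n. P j x} \<inter> {x \<in> X. P n x}"
    by (auto simp: less_Suc_eq)
  with Suc show ?case by auto
qed simp

definition word :: "nat \<Rightarrow> 'a \<Rightarrow> bool list"
  where "word n x = map (\<lambda>i. sym ((f ^^ i) x)) [0..<n]"

lemma length_word [simp]: "length (word n x) = n"
  by (simp add: word_def)

lemma word_eq_iff: "word n x = word n y \<longleftrightarrow> (\<forall>i<n. sym ((f ^^ i) x) = sym ((f ^^ i) y))"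
  by (simp add: word_def list_eq_iff_nth_eq)

lemma word_eq_list_iff: "length w = n \<Longrightarrow> word n x = w \<longleftrightarrow> (\<forall>i<n. sym ((f ^^ i) x) = w ! i)"
  by (auto simp: word_def list_eq_iff_nth_eq)

lemma openin_word: "openin (top_of_set X) {x \<in> X. P (word n x)}"
proof -
  have "{x \<in> X. P (word n x)} =
      \<Union> ((\<lambda>w. {x \<in> X. \<forall>i<n. sym ((f ^^ i) x) = w ! i}) ` {w. length w = n \<and> P w})"
    by (auto simp: word_eq_list_iff[symmetric])
  moreover have "openin (top_of_set X) {x \<in> X. \<forall>i<n. sym ((f ^^ i) x) = w ! i}" for w
    by (intro openin_Ball_lessThan openin_sym_funpow)
  ultimately show ?thesis by auto
qed

lemma closed_word: "closed {x \<in> X. P (word n x)}"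
proof -
  have "{x \<in> X. P (word n x)} = X - {x \<in> X. \<not> P (word n x)}" by auto
  then have "closedin (top_of_set X) {x \<in> X. P (word n x)}"
    using openin_word[of "\<lambda>w. \<not> P w" n] by (simp add: openin_closedin_eq)
  then show ?thesis using closedin_closed_trans compact_imp_closed[OF compact_X] by blast
qed

lemma realize_word:
  assumes "length w = n"
  obtains x where "x \<in> X" "word n x = w"
  using realize[of "\<lambda>i. w ! i"] assms by (auto simp: word_eq_list_iff)

lemma openin_string_set:
  assumes "open_cover X \<U>" "Us \<in> lists \<U>"
  shows "openin (top_of_set X) (string_set f X Us)"
  unfolding string_set_def
proof (intro openin_Ball_lessThan openin_preimage_funpow)
  fix j assume "j < length Us"
  then have "Us ! j \<in> \<U>" using assms(2) by (auto simp: in_lists_conv_set)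
  then show "openin (top_of_set X) (Us ! j)" using assms(1) by (simp add: open_cover_def)
qed

lemma openin_finite_subcover:
  assumes "compact M" "M \<subseteq> X" "\<And>c. c \<in> C \<Longrightarrow> openin (top_of_set X) (g c)" "M \<subseteq> (\<Union>c\<in>C. g c)"
  obtains C' where "C' \<subseteq> C" "finite C'" "M \<subseteq> (\<Union>c\<in>C'. g c)"
proof -
  have "\<exists>T. open T \<and> g c = X \<inter> T" if "c \<in> C" for c
    using assms(3)[OF that] by (simp add: openin_open)
  then obtain T where T: "\<And>c. c \<in> C \<Longrightarrow> open (T c)" "\<And>c. c \<in> C \<Longrightarrow> g c = X \<inter> T c"
    by metis
  have "M \<subseteq> (\<Union>c\<in>C. T c)" using assms(4) T(2) by fastforce
  then obtain C' where C': "C' \<subseteq> C" "finite C'" "M \<subseteq> (\<Union>c\<in>C'. T c)"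
    using compactE_image[OF assms(1), of C T] T(1) by metis
  show ?thesis
  proof (rule that[OF C'(1,2)])
    show "M \<subseteq> (\<Union>c\<in>C'. g c)" using C' T(2) assms(2) by fastforce
  qed
qed

lemma lebesgue_number:
  assumes "open_cover X \<U>"
  obtains e where "0 < e" "\<And>x. x \<in> X \<Longrightarrow> \<exists>U\<in>\<U>. ball x e \<inter> X \<subseteq> U"
proof -
  let ?G = "{T. open T \<and> X \<inter> T \<in> \<U>}"
  have "X \<subseteq> \<Union>?G"
  proof
    fix x assume "x \<in> X"
    then obtain U where U: "U \<in> \<U>" "x \<in> U" using assms by (auto simp: open_cover_def)
    then obtain T where "open T" "U = X \<inter> T" using assms by (auto simp: open_cover_def openin_open)
    with U show "x \<in> \<Union>?G" by auto
  qed
  then obtain e where "0 < e" and e: "\<And>x. x \<in> X \<Longrightarrow> \<exists>T\<in>?G. ball x e \<subseteq> T"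
    by (rule Heine_Borel_lemma[OF compact_X]) (simp, rule that)
  show ?thesis
  proof (rule that[OF \<open>0 < e\<close>])
    fix x assume "x \<in> X"
    then obtain T where "X \<inter> T \<in> \<U>" "ball x e \<subseteq> T" using e by blast
    then show "\<exists>U\<in>\<U>. ball x e \<inter> X \<subseteq> U" by (intro bexI[of _ "X \<inter> T"]) auto
  qed
qed

text \<open>A word of length \<open>n + 2 * k\<close> controls the \<open>n\<close> states from time
  \<open>k\<close> on, up to a Lebesgue number of the cover. One string per word then suffices, and
  the factor \<open>2 ^ (2 * k)\<close> does not affect growth rates. Both upper bounds for
  entropies use this.\<close>

lemma string_cover_card_le:
  assumes "open_cover X \<U>"
  obtains k where "\<And>n. \<exists>G. G \<subseteq> lists \<U> \<and> finite G \<and> card G \<le> 2 ^ (n + 2 * k) \<and>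
    (\<forall>Us\<in>G. length Us = n) \<and> X \<subseteq> (\<Union>Us\<in>G. string_set f X Us)"
proof -
  obtain e where "0 < e" and "\<And>x. x \<in> X \<Longrightarrow> \<exists>U\<in>\<U>. ball x e \<inter> X \<subseteq> U"
    using lebesgue_number[OF assms] by blast
  then obtain V where V: "\<And>x. x \<in> X \<Longrightarrow> V x \<in> \<U>" "\<And>x. x \<in> X \<Longrightarrow> ball x e \<inter> X \<subseteq> V x" by metis
  obtain k where k: "\<And>x y. x \<in> X \<Longrightarrow> y \<in> X \<Longrightarrow> \<forall>i\<le>2 * k. sym ((f ^^ i) x) = sym ((f ^^ i) y) \<Longrightarrow>
      dist ((f ^^ k) x) ((f ^^ k) y) < e"
    using expansive[OF \<open>0 < e\<close>] by blast
  show ?thesis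
  proof (rule that[of k])
    fix n
    let ?W = "{w :: bool list. set w \<subseteq> UNIV \<and> length w = n + 2 * k}"
    have "\<forall>w\<in>?W. \<exists>z. z \<in> X \<and> word (n + 2 * k) z = w"
      using realize_word by blast
    from bchoice[OF this] obtain z
      where z: "\<And>w. w \<in> ?W \<Longrightarrow> z w \<in> X" "\<And>w. w \<in> ?W \<Longrightarrow> word (n + 2 * k) (z w) = w"
      by blast
    define s where "s w = map (\<lambda>j. V ((f ^^ (k + j)) (z w))) [0..<n]" for w
    have fin: "finite ?W" by (rule finite_lists_length_eq) simp
    have "s ` ?W \<subseteq> lists \<U>" using V(1) z(1) funpow_mem by (auto simp: s_def)
    moreover have "finite (s ` ?W)" using fin by simp
    moreover have "card (s ` ?W) \<le> 2 ^ (n + 2 * k)"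
      using card_image_le[OF fin, of s] card_lists_length_eq[of "UNIV :: bool set" "n + 2 * k"] by simp
    moreover have "\<forall>Us\<in>s ` ?W. length Us = n" by (simp add: s_def)
    moreover have "X \<subseteq> (\<Union>Us\<in>s ` ?W. string_set f X Us)"
    proof
      fix y assume y: "y \<in> X"
      \<comment> \<open>The word is read off a \<open>k\<close>-th preimage of \<open>y\<close>,
        whose first \<open>k\<close> symbols represent the past of \<open>y\<close>.\<close>
      then have "y \<in> (f ^^ k) ` X" by (simp only: funpow_image)
      then obtain x where x: "x \<in> X" "(f ^^ k) x = y" by (auto simp only: image_iff)
      let ?w = "word (n + 2 * k) x"
      have w: "?w \<in> ?W" by simp
      have "(f ^^ j) y \<in> s ?w ! j" if "j < n" for j
      proof -
        have "\<forall>i<n + 2 * k. sym ((f ^^ i) (z ?w)) = sym ((f ^^ i) x)"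
          using z(2)[OF w] by (simp only: word_eq_iff)
        then have "\<forall>i\<le>2 * k. sym ((f ^^ i) ((f ^^ j) (z ?w))) = sym ((f ^^ i) ((f ^^ j) x))"
          using that by (simp add: funpow_funpow)
        from k[OF funpow_mem[OF z(1)[OF w]] funpow_mem[OF x(1)] this]
        have "dist ((f ^^ (k + j)) (z ?w)) ((f ^^ (k + j)) x) < e" by (simp add: funpow_add)
        moreover have "(f ^^ (k + j)) x = (f ^^ j) y"
          by (simp add: funpow_funpow add.commute flip: x(2))
        ultimately have "(f ^^ j) y \<in> ball ((f ^^ (k + j)) (z ?w)) e \<inter> X"
          using funpow_mem[OF y] by simp
        with V(2)[OF funpow_mem[OF z(1)[OF w]], of "k + j"]
        have "(f ^^ j) y \<in> V ((f ^^ (k + j)) (z ?w))" by blast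
        then show ?thesis using that by (simp add: s_def)
      qed
      then have "y \<in> string_set f X (s ?w)" using y by (simp add: string_set_def s_def)
      then show "y \<in> (\<Union>Us\<in>s ` ?W. string_set f X Us)" using w by blast
    qed
    ultimately show "\<exists>G. G \<subseteq> lists \<U> \<and> finite G \<and> card G \<le> 2 ^ (n + 2 * k) \<and>
        (\<forall>Us\<in>G. length Us = n) \<and> X \<subseteq> (\<Union>Us\<in>G. string_set f X Us)"
      by blast
  qed
qed

end

section \<open>Upper bound for the entropy of subsets\<close>

text \<open>A larger \<open>n\<close> leaves fewer admissible collections, so the infima increase
  and their limit is a supremum.\<close>

lemma cover_measure_eq_SUP:
  "cover_measure f X \<U> Z \<alpha> =
    (SUP n. INF \<G>\<in>string_covers f X \<U> Z n. \<Sum>\<^sub>\<infinity>Us\<in>\<G>. ennreal (exp (- \<alpha> * real (length Us))))"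
  unfolding cover_measure_def
proof (rule limI, rule LIMSEQ_SUP, rule incseq_SucI)
  show "(INF \<G>\<in>string_covers f X \<U> Z n. \<Sum>\<^sub>\<infinity>Us\<in>\<G>. ennreal (exp (- \<alpha> * real (length Us))))
    \<le> (INF \<G>\<in>string_covers f X \<U> Z (Suc n). \<Sum>\<^sub>\<infinity>Us\<in>\<G>. ennreal (exp (- \<alpha> * real (length Us))))" for n
    by (rule INF_superset_mono) (auto simp: string_covers_def Suc_le_eq dest: less_imp_le)
qed

context binary_coding
begin

lemma cover_measure_eq_0:
  assumes "open_cover X \<U>" "Z \<subseteq> X" "ln 2 < \<alpha>"
  shows "cover_measure f X \<U> Z \<alpha> = 0"
proof -
  let ?I = "\<lambda>n. INF \<G>\<in>string_covers f X \<U> Z n. \<Sum>\<^sub>\<infinity>Us\<in>\<G>. ennreal (exp (- \<alpha> * real (length Us)))"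
  obtain k where k: "\<And>n. \<exists>G. G \<subseteq> lists \<U> \<and> finite G \<and> card G \<le> 2 ^ (n + 2 * k) \<and>
    (\<forall>Us\<in>G. length Us = n) \<and> X \<subseteq> (\<Union>Us\<in>G. string_set f X Us)"
    using string_cover_card_le[OF assms(1)] by blast
  \<comment> \<open>The estimate holds for every \<open>n \<ge> N\<close>, so for fixed
    \<open>N\<close> the infimum can be compared with the limit as \<open>n\<close> grows, which is
    0 because \<open>ln 2 < \<alpha>\<close>.\<close>
  have bound: "?I N \<le> ennreal (4 ^ k * (2 * exp (- \<alpha>)) ^ n)" if "N \<le> n" for N n
  proof -
    obtain G where G: "G \<subseteq> lists \<U>" "finite G" "card G \<le> 2 ^ (n + 2 * k)"
      "\<forall>Us\<in>G. length Us = n" "X \<subseteq> (\<Union>Us\<in>G. string_set f X Us)"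
      using k[of n] by blast
    then have "G \<in> string_covers f X \<U> Z N"
      using assms(2) that by (auto simp: string_covers_def countable_finite)
    then have "?I N \<le> (\<Sum>\<^sub>\<infinity>Us\<in>G. ennreal (exp (- \<alpha> * real (length Us))))"
      by (rule INF_lower)
    also have "\<dots> = (\<Sum>Us\<in>G. ennreal (exp (- \<alpha> * real n)))"
      using G(2,4) by (simp add: infsum_finite)
    also have "\<dots> = ennreal (real (card G) * exp (- \<alpha>) ^ n)"
      by (simp add: ennreal_mult ennreal_of_nat_eq_real_of_nat exp_of_nat_mult[symmetric] mult.commute)
    also have "\<dots> \<le> ennreal (2 ^ (n + 2 * k) * exp (- \<alpha>) ^ n)"
    proof (intro ennreal_leI mult_right_mono)
      show "real (card G) \<le> 2 ^ (n + 2 * k)" using G(3) by (metis of_nat_le_iff of_nat_numeral of_nat_power)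
    qed simp
    also have "2 ^ (n + 2 * k) * exp (- \<alpha>) ^ n = 4 ^ k * (2 * exp (- \<alpha>)) ^ n"
      by (simp add: power_add power_mult power_mult_distrib)
    finally show ?thesis .
  qed
  have "exp (- \<alpha>) < exp (- ln 2)" using assms(3) by simp
  then have "2 * exp (- \<alpha>) < 1" by (simp add: exp_minus)
  then have "(\<lambda>n. 4 ^ k * (2 * exp (- \<alpha>)) ^ n) \<longlonglongrightarrow> 4 ^ k * 0"
    by (intro tendsto_intros LIMSEQ_realpow_zero) auto
  then have lim: "(\<lambda>n. ennreal (4 ^ k * (2 * exp (- \<alpha>)) ^ n)) \<longlonglongrightarrow> 0"
    using tendsto_ennrealI by fastforce
  have "?I N \<le> 0" for N
    by (rule tendsto_lowerbound[OF lim]) (use bound in \<open>auto simp: eventually_sequentially\<close>)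
  then show ?thesis by (simp add: cover_measure_eq_SUP)
qed

lemma cover_entropy_le:
  assumes "open_cover X \<U>" "Z \<subseteq> X"
  shows "cover_entropy f X \<U> Z \<le> ereal (ln 2)"
proof (rule dense_ge)
  fix y assume y: "ereal (ln 2) < y"
  show "cover_entropy f X \<U> Z \<le> y"
  proof (cases y)
    case (real r)
    with y have "cover_measure f X \<U> Z r = 0" using cover_measure_eq_0[OF assms] by simp
    then show ?thesis unfolding cover_entropy_def real by (intro Inf_lower) auto
  qed (use y in auto)
qed


section \<open>Lower bound from independent blocks\<close>

definition block :: "nat \<Rightarrow> nat \<Rightarrow> 'a \<Rightarrow> bool list"
  where "block k j x = map (\<lambda>i. sym ((f ^^ (j * k + i)) x)) [0..<k]"

definition majority_set :: "nat \<Rightarrow> (nat \<Rightarrow> bool) \<Rightarrow> 'a set"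
  where "majority_set k g = {x \<in> X. \<forall>j. block k j x \<in> majority_words k (g j)}"

lemma block_eq_drop_word: "block k j x = drop (j * k) (word (j * k + k) x)"
  by (simp add: list_eq_iff_nth_eq block_def word_def)

lemma majority_set_subset: "majority_set k g \<subseteq> X"
  by (auto simp: majority_set_def)

text \<open>Each condition concerns finitely many symbols and is therefore closed. Compactness later
  allows a countable cover by strings to be replaced by a finite one.\<close>

lemma compact_majority_set: "compact (majority_set k g)"
proof -
  have "majority_set k g = X \<inter> (\<Inter>j. {x \<in> X. drop (j * k) (word (j * k + k) x) \<in> majority_words k (g j)})"
    by (auto simp: majority_set_def block_eq_drop_word)
  moreover have "closed (\<Inter>j. {x \<in> X. drop (j * k) (word (j * k + k) x) \<in> majority_words k (g j)})"
    by (intro closed_INT ballI closed_word)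
  ultimately show ?thesis using compact_X by (simp add: compact_Int_closed)
qed

text \<open>The blocks are independent of each other: the first \<open>J\<close> are free within
  their majority classes, and the later ones are filled with constant words, which have the required
  majority because \<open>0 < k\<close>.\<close>

lemma realize_blocks:
  assumes "0 < k" and c: "\<And>j. j < J \<Longrightarrow> c j \<in> majority_words k (g j)"
  obtains x where "x \<in> majority_set k g" "\<And>j. j < J \<Longrightarrow> block k j x = c j"
proof -
  obtain x where x: "x \<in> X"
    "\<And>i. sym ((f ^^ i) x) = (if i div k < J then c (i div k) ! (i mod k) else g (i div k))"
    using realize[of "\<lambda>i. if i div k < J then c (i div k) ! (i mod k) else g (i div k)"] by blast
  have 1: "block k j x = c j" if "j < J" for j
    using c[OF that] that \<open>0 < k\<close>
    by (auto simp: list_eq_iff_nth_eq block_def x(2) majority_words_def)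
  have 2: "block k j x = replicate k (g j)" if "\<not> j < J" for j
    using that \<open>0 < k\<close> by (auto simp: list_eq_iff_nth_eq block_def x(2))
  have "block k j x \<in> majority_words k (g j)" for j
    using 1 2 c replicate_in_majority_words[OF \<open>0 < k\<close>] by (cases "j < J") auto
  then have "x \<in> majority_set k g"
    using x(1) by (simp add: majority_set_def)
  then show ?thesis using 1 that by blast
qed

text \<open>
  A Kraft inequality: a string of length \<open>m\<close> fixes the first \<open>m div k\<close> blocks, so it covers at
  most the fraction \<open>1 / 4^(r * (m div k))\<close> of the admissible sequences of blocks.
\<close>

lemma string_sum_ge:
  assumes cover: "open_cover X \<U>" and fine: "\<And>U x y. U \<in> \<U> \<Longrightarrow> x \<in> U \<Longrightarrow> y \<in> U \<Longrightarrow> sym x = sym y"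
    and k: "k = 2 * r + 1" and Z: "majority_set k g \<subseteq> Z" and \<alpha>: "\<alpha> * real k \<le> 2 * real r * ln 2"
    and G: "G \<in> string_covers f X \<U> Z n"
  shows "ennreal (1 / 4 ^ r) \<le> (\<Sum>\<^sub>\<infinity>Us\<in>G. ennreal (exp (- \<alpha> * real (length Us))))"
proof -
  let ?M = "majority_set k g" and ?A = "\<lambda>j. majority_words k (g j)" and ?K = "4 ^ r :: nat"
  have "0 < k" using k by simp
  have G': "G \<subseteq> lists \<U>" "?M \<subseteq> (\<Union>Us\<in>G. string_set f X Us)"
    using G Z by (auto simp: string_covers_def)
  obtain H where H: "H \<subseteq> G" "finite H" "?M \<subseteq> (\<Union>Us\<in>H. string_set f X Us)"
    by (rule openin_finite_subcover[OF compact_majority_set majority_set_subset _ G'(2)])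
      (use openin_string_set[OF cover] G'(1) in blast)
  \<comment> \<open>\<open>J\<close> bounds the length of every string in \<open>H\<close>, so
    \<open>J\<close> blocks contain all the times that these strings see.\<close>
  define J where "J = (\<Sum>Us\<in>H. length Us)"
  have J: "length Us \<le> J" if "Us \<in> H" for Us
    unfolding J_def by (rule member_le_sum) (use that H in auto)
  let ?P = "Pi\<^sub>E {..<J} ?A"
  \<comment> \<open>One sample point for each admissible sequence of \<open>J\<close> blocks.
    Counting the sample points in the set of a string takes the place of a uniform measure.\<close>
  have "\<forall>c\<in>?P. \<exists>x. x \<in> ?M \<and> (\<forall>j<J. block k j x = c j)"
  proof
    fix c assume "c \<in> ?P"
    then have "\<And>j. j < J \<Longrightarrow> c j \<in> ?A j" by auto
    then show "\<exists>x. x \<in> ?M \<and> (\<forall>j<J. block k j x = c j)"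
      using realize_blocks[OF \<open>0 < k\<close>] by metis
  qed
  from bchoice[OF this] obtain x
    where x: "\<And>c. c \<in> ?P \<Longrightarrow> x c \<in> ?M" "\<And>c j. c \<in> ?P \<Longrightarrow> j < J \<Longrightarrow> block k j (x c) = c j"
    by blast
  define C where "C Us = {c \<in> ?P. x c \<in> string_set f X Us}" for Us
  have finP: "finite ?P" by (intro finite_PiE) auto
  have card_A: "card (?A j) = ?K" for j using card_majority_words[of r "g j"] k by simp
  have card_C: "card (C Us) \<le> ?K ^ (J - length Us div k)" if Us: "Us \<in> H" for Us
  proof (rule card_PiE_agree_le)
    show "C Us \<subseteq> ?P" by (auto simp: C_def)
    show "length Us div k \<le> J" using J[OF Us] div_le_dividend le_trans by blast
    fix c d j assume c: "c \<in> C Us" and d: "d \<in> C Us" and j: "j < length Us div k"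
    \<comment> \<open>A string determines the blocks that end before it does:
      \<open>j < length Us div k\<close> gives \<open>(j + 1) * k \<le> length Us\<close>.\<close>
    have jk: "j * k + i < length Us" if "i < k" for i
    proof -
      have "j * k + i < (j + 1) * k" using that by simp
      also have "\<dots> \<le> length Us div k * k" using j by (intro mult_le_mono1) simp
      also have "\<dots> \<le> length Us" by simp
      finally show ?thesis .
    qed
    have "sym ((f ^^ i) (x c)) = sym ((f ^^ i) (x d))" if "i < length Us" for i
    proof (rule fine)
      show "Us ! i \<in> \<U>" using that Us H(1) G'(1) by (auto simp: in_lists_conv_set)
    qed (use c d that in \<open>auto simp: C_def string_set_def\<close>)
    then have "block k j (x c) = block k j (x d)" using jk by (simp add: block_def)
    moreover have "j < J" using j J[OF Us] by (meson div_le_dividend le_trans less_le_trans)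
    ultimately show "c j = d j" using x(2) c d by (simp add: C_def)
  qed (simp_all add: card_A)
  have "?P = (\<Union>Us\<in>H. C Us)" using H(3) x(1) by (fastforce simp: C_def)
  then have "card ?P \<le> (\<Sum>Us\<in>H. card (C Us))" using card_UN_le[OF H(2)] by simp
  also have "\<dots> \<le> (\<Sum>Us\<in>H. ?K ^ (J - length Us div k))" by (intro sum_mono card_C)
  finally have "?K ^ J \<le> (\<Sum>Us\<in>H. ?K ^ (J - length Us div k))" by (simp add: card_PiE card_A)
  then have "real (?K ^ J) \<le> real (\<Sum>Us\<in>H. ?K ^ (J - length Us div k))" by (simp only: of_nat_le_iff)
  also have "\<dots> = (\<Sum>Us\<in>H. (4 ^ r) ^ (J - length Us div k))" by simp
  \<comment> \<open>The hypothesis on \<alpha> says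
    \<open>exp (- \<alpha> * k) \<ge> 1 / 4 ^ r\<close>, so a string of length at most
    \<open>k * (q + 1)\<close> has weight at least \<open>1 / (4 ^ r) ^ (q + 1)\<close>. Rounding up
    to whole blocks costs the extra factor \<open>4 ^ r\<close>.\<close>
  also have "\<dots> \<le> (\<Sum>Us\<in>H. (4 ^ r) ^ J * 4 ^ r * exp (- \<alpha> * real (length Us)))"
  proof (rule sum_mono)
    fix Us assume Us: "Us \<in> H"
    define q where "q = length Us div k"
    have "length Us \<le> k * (q + 1)"
      unfolding q_def using \<open>0 < k\<close> by (metis add.commute dividend_less_div_times less_imp_le mult.commute mult_Suc_right plus_1_eq_Suc)
    have "q \<le> J" unfolding q_def using J[OF Us] div_le_dividend le_trans by blast
    have "\<alpha> * real (length Us) * real k \<le> 2 * real r * ln 2 * real (length Us)"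
      using mult_right_mono[OF \<alpha>, of "real (length Us)"] by (simp add: algebra_simps)
    also have "\<dots> \<le> 2 * real r * ln 2 * real (k * (q + 1))"
      using \<open>length Us \<le> k * (q + 1)\<close> by (intro mult_left_mono of_nat_mono) auto
    finally have "\<alpha> * real (length Us) * real k \<le> 2 * real r * ln 2 * real (q + 1) * real k"
      by (simp add: algebra_simps)
    then have "\<alpha> * real (length Us) \<le> 2 * real r * ln 2 * real (q + 1)"
      using \<open>0 < k\<close> by (simp only: mult_le_cancel_right_pos of_nat_0_less_iff)
    also have "\<dots> = ln (4 ^ (r * (q + 1)))"
      using ln_realpow[of 2 2] by (simp add: ln_realpow algebra_simps)
    finally have "exp (- ln (4 ^ (r * (q + 1)))) \<le> exp (- \<alpha> * real (length Us))" by simp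
    then have "1 \<le> 4 ^ (r * (q + 1)) * exp (- \<alpha> * real (length Us))"
      by (simp add: exp_minus field_simps)
    then have "1 \<le> (4 ^ r) ^ (q + 1) * exp (- \<alpha> * real (length Us))"
      by (simp only: power_mult)
    then have "(4 ^ r) ^ (J - q) * 1 \<le> (4 ^ r) ^ (J - q) * ((4 ^ r) ^ (q + 1) * exp (- \<alpha> * real (length Us)))"
      by (intro mult_left_mono) auto
    also have "\<dots> = (4 ^ r) ^ (J - q + q) * 4 ^ r * exp (- \<alpha> * real (length Us))"
      by (simp only: power_add power_one_right mult.assoc)
    finally show "(4 ^ r) ^ (J - length Us div k) \<le> (4 ^ r) ^ J * 4 ^ r * exp (- \<alpha> * real (length Us))"
      using \<open>q \<le> J\<close> by (simp add: q_def)
  qed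
  also have "\<dots> = (4 ^ r) ^ J * (4 ^ r * (\<Sum>Us\<in>H. exp (- \<alpha> * real (length Us))))"
    by (simp add: sum_distrib_left mult.assoc)
  finally have "1 \<le> 4 ^ r * (\<Sum>Us\<in>H. exp (- \<alpha> * real (length Us)))" by simp
  then have "ennreal (1 / 4 ^ r) \<le> ennreal (\<Sum>Us\<in>H. exp (- \<alpha> * real (length Us)))"
    by (intro ennreal_leI) (simp add: field_simps)
  also have "\<dots> = (\<Sum>Us\<in>H. ennreal (exp (- \<alpha> * real (length Us))))" by simp
  also have "\<dots> = (\<Sum>\<^sub>\<infinity>Us\<in>H. ennreal (exp (- \<alpha> * real (length Us))))"
    using H(2) by (simp add: infsum_finite)
  also have "\<dots> \<le> (\<Sum>\<^sub>\<infinity>Us\<in>G. ennreal (exp (- \<alpha> * real (length Us))))"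
    using H(1) by (intro infsum_mono_neutral nonneg_summable_on_complete) auto
  finally show ?thesis .
qed

text \<open>For \<alpha> below \<open>ln 2\<close>, a long odd block length \<open>k\<close>
  achieves \<open>\<alpha> \<le> (1 - 1 / k) * ln 2\<close>, and then all string sums stay above the
  positive constant \<open>1 / 4 ^ r\<close>.\<close>

lemma cover_entropy_ge:
  assumes cover: "open_cover X \<U>" and fine: "\<And>U x y. U \<in> \<U> \<Longrightarrow> x \<in> U \<Longrightarrow> y \<in> U \<Longrightarrow> sym x = sym y"
    and Z: "\<And>k. 0 < k \<Longrightarrow> \<exists>g. majority_set k g \<subseteq> Z"
  shows "ereal (ln 2) \<le> cover_entropy f X \<U> Z"
  unfolding cover_entropy_def
proof (rule Inf_greatest, clarify)
  fix \<alpha> assume "cover_measure f X \<U> Z \<alpha> = 0"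
  have False if "\<alpha> < ln 2"
  proof -
    \<comment> \<open>With \<open>k = 2 * r + 1\<close>, the required
      \<open>\<alpha> * k \<le> 2 * r * ln 2\<close> amounts to
      \<open>ln 2 \<le> k * (ln 2 - \<alpha>)\<close>.\<close>
    obtain r :: nat where r: "ln 2 / (ln 2 - \<alpha>) \<le> real r" using real_arch_simple by blast
    let ?k = "2 * r + 1"
    obtain g where g: "majority_set ?k g \<subseteq> Z" using Z[of ?k] by auto
    have "ln 2 \<le> real r * (ln 2 - \<alpha>)" using r that by (simp add: field_simps)
    also have "\<dots> \<le> real ?k * (ln 2 - \<alpha>)" using that by (intro mult_right_mono) auto
    finally have \<alpha>: "\<alpha> * real ?k \<le> 2 * real r * ln 2" by (simp add: algebra_simps)
    have "ennreal (1 / 4 ^ r) \<le> cover_measure f X \<U> Z \<alpha>"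
      unfolding cover_measure_eq_SUP
      by (intro SUP_upper2[of 0] INF_greatest string_sum_ge[OF cover fine refl g \<alpha>]) auto
    moreover have "0 < ennreal (1 / 4 ^ r)" by (intro ennreal_less_zero_iff[THEN iffD2]) simp
    ultimately show False using \<open>cover_measure f X \<U> Z \<alpha> = 0\<close> by simp
  qed
  then show "ereal (ln 2) \<le> ereal \<alpha>" by force
qed

lemma symbol_cover: "open_cover X (range (\<lambda>b. {x \<in> X. sym x = b}))"
  by (auto simp: open_cover_def openin_sym)

lemma nonempty: "X \<noteq> {}"
  using realize by blast

section \<open>The limit along fine covers\<close>

lemma eventually_fine_covers:
  "eventually P (fine_covers X) \<longleftrightarrow>
    (\<exists>e>0. \<forall>\<U>. finite \<U> \<and> open_cover X \<U> \<and> (\<forall>U\<in>\<U>. diameter U < e) \<longrightarrow> P \<U>)"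
  unfolding fine_covers_def
proof (subst eventually_INF_base)
  fix a b :: real assume "a \<in> {0<..}" "b \<in> {0<..}"
  then show "\<exists>x\<in>{0<..}. principal {\<U>. finite \<U> \<and> open_cover X \<U> \<and> (\<forall>U\<in>\<U>. diameter U < x)}
      \<le> inf (principal {\<U>. finite \<U> \<and> open_cover X \<U> \<and> (\<forall>U\<in>\<U>. diameter U < a)})
          (principal {\<U>. finite \<U> \<and> open_cover X \<U> \<and> (\<forall>U\<in>\<U>. diameter U < b)})"
    by (intro bexI[of _ "min a b"]) auto
qed (auto simp: eventually_principal Bex_def)

text \<open>By compactness, finitely many balls of radius \<open>e / 3\<close> cover
  \<open>X\<close>, and their diameter is at most \<open>2 * (e / 3)\<close>. Limits along a
  nontrivial filter are unique, which makes \<open>Lim\<close> meaningful.\<close>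

lemma fine_covers_neq_bot: "fine_covers X \<noteq> bot"
proof
  assume "fine_covers X = bot"
  then have "eventually (\<lambda>_. False) (fine_covers X)" by simp
  then obtain e where "0 < e" and e: "\<And>\<U>. finite \<U> \<Longrightarrow> open_cover X \<U> \<Longrightarrow> \<exists>U\<in>\<U>. \<not> diameter U < e"
    unfolding eventually_fine_covers by auto
  let ?B = "\<lambda>x. X \<inter> ball x (e / 3)"
  have opn: "openin (top_of_set X) (?B x)" for x by (rule openin_open_Int) simp
  have "X \<subseteq> (\<Union>x\<in>X. ?B x)" using \<open>0 < e\<close> by auto
  then obtain C where C: "C \<subseteq> X" "finite C" "X \<subseteq> (\<Union>x\<in>C. ?B x)"
    by (rule openin_finite_subcover[OF compact_X order_refl opn])
  then have "open_cover X (?B ` C)" using opn by (auto simp: open_cover_def)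
  then obtain x where x: "x \<in> C" "\<not> diameter (?B x) < e" using e[of "?B ` C"] C(2) by auto
  have *: "(case p of (y, z) \<Rightarrow> dist y z) \<le> 2 * (e / 3)" if "p \<in> ?B x \<times> ?B x" for p
    using that dist_triangle_less_add[of "fst p" x "e / 3" "snd p" "e / 3"]
    by (auto simp: dist_commute split_beta)
  have "(SUP p\<in>?B x \<times> ?B x. case p of (y, z) \<Rightarrow> dist y z) \<le> 2 * (e / 3)" if "?B x \<noteq> {}"
  proof (rule cSUP_least)
    show "?B x \<times> ?B x \<noteq> {}" using that by blast
  qed (rule *)
  then have "diameter (?B x) \<le> 2 * (e / 3)"
    unfolding diameter_def using \<open>0 < e\<close> by simp
  then show False using x \<open>0 < e\<close> by simp
qed

text \<open>Below the Lebesgue number of the symbol cover, every member of a cover carries a single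
  symbol, so the upper and the lower bound agree. The entropy is constant along fine covers, and its
  limit is immediate.\<close>

lemma subset_entropy_eq:
  assumes "Z \<subseteq> X" and Z: "\<And>k. 0 < k \<Longrightarrow> \<exists>g. majority_set k g \<subseteq> Z"
  shows "subset_entropy f X Z = ereal (ln 2)"
proof -
  obtain e where "0 < e" and e: "\<And>x. x \<in> X \<Longrightarrow> \<exists>U\<in>range (\<lambda>b. {x \<in> X. sym x = b}). ball x e \<inter> X \<subseteq> U"
    using lebesgue_number[OF symbol_cover] by blast
  have "cover_entropy f X \<U> Z = ereal (ln 2)"
    if \<U>: "finite \<U>" "open_cover X \<U>" "\<forall>U\<in>\<U>. diameter U < e" for \<U>
  proof (rule antisym)
    show "cover_entropy f X \<U> Z \<le> ereal (ln 2)" by (rule cover_entropy_le[OF \<U>(2) assms(1)])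
    show "ereal (ln 2) \<le> cover_entropy f X \<U> Z"
    proof (rule cover_entropy_ge[OF \<U>(2) _ Z])
      fix U x y assume U: "U \<in> \<U>" "x \<in> U" "y \<in> U"
      then have "U \<subseteq> X" using \<U>(2) by (auto simp: open_cover_def)
      then have "dist x y \<le> diameter U"
        using U bounded_subset[OF compact_imp_bounded[OF compact_X]] by (intro diameter_bounded_bound)
      then have "dist x y < e" using \<U>(3) U(1) by fastforce
      then have "y \<in> ball x e \<inter> X" "x \<in> ball x e \<inter> X" using U \<open>U \<subseteq> X\<close> \<open>0 < e\<close> by auto
      moreover obtain b where "ball x e \<inter> X \<subseteq> {x \<in> X. sym x = b}"
        using e[of x] U(2) \<open>U \<subseteq> X\<close> by blast
      ultimately have "y \<in> {x \<in> X. sym x = b}" "x \<in> {x \<in> X. sym x = b}" by blast+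
      then show "sym x = sym y" by simp
    qed
  qed
  then have "eventually (\<lambda>\<U>. cover_entropy f X \<U> Z = ereal (ln 2)) (fine_covers X)"
    unfolding eventually_fine_covers using \<open>0 < e\<close> by blast
  then show ?thesis
    unfolding subset_entropy_def
    by (intro tendsto_Lim[OF fine_covers_neq_bot] tendsto_eventually)
qed


section \<open>Entropy of the whole system by minimal subcovers\<close>

lemma min_subcover_card_le:
  "\<V> \<subseteq> \<U> \<Longrightarrow> finite \<V> \<Longrightarrow> \<Union>\<V> = X \<Longrightarrow> min_subcover_card X \<U> \<le> card \<V>"
  unfolding min_subcover_card_def by (intro cInf_lower) auto

lemma min_subcover_card_attained:
  assumes "open_cover X \<U>"
  obtains \<V> where "\<V> \<subseteq> \<U>" "finite \<V>" "\<Union>\<V> = X" "card \<V> = min_subcover_card X \<U>"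
proof -
  obtain \<W> where \<W>: "\<W> \<subseteq> \<U>" "finite \<W>" "X \<subseteq> (\<Union>U\<in>\<W>. U)"
    by (rule openin_finite_subcover[OF compact_X order_refl, of \<U> "\<lambda>U. U"])
      (use assms in \<open>auto simp: open_cover_def\<close>)
  then have "\<Union>\<W> = X" using assms by (auto simp: open_cover_def)
  with \<W> have "card ` {\<V>. \<V> \<subseteq> \<U> \<and> finite \<V> \<and> \<Union>\<V> = X} \<noteq> {}" by auto
  from Inf_nat_def1[OF this]
  have "min_subcover_card X \<U> \<in> card ` {\<V>. \<V> \<subseteq> \<U> \<and> finite \<V> \<and> \<Union>\<V> = X}"
    by (simp add: min_subcover_card_def)
  then show ?thesis using that by force
qed

lemma min_subcover_card_pos: "open_cover X \<U> \<Longrightarrow> 0 < min_subcover_card X \<U>"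
  using nonempty by (metis Union_empty card_gt_0_iff min_subcover_card_attained)

lemma string_set_append:
  "string_set f X (Us @ Vs) = string_set f X Us \<inter> {x \<in> X. (f ^^ length Us) x \<in> string_set f X Vs}"
proof -
  have "(\<forall>j<length (Us @ Vs). (f ^^ j) x \<in> (Us @ Vs) ! j) \<longleftrightarrow>
      (\<forall>j<length Us. (f ^^ j) x \<in> Us ! j) \<and> (\<forall>j<length Vs. (f ^^ j) ((f ^^ length Us) x) \<in> Vs ! j)"
    (is "?l \<longleftrightarrow> ?r1 \<and> ?r2") for x
  proof safe
    fix j assume l: ?l and j: "j < length Us"
    then show "(f ^^ j) x \<in> Us ! j" by (auto simp: nth_append dest!: spec[of _ j])
  next
    fix j assume l: ?l and j: "j < length Vs"
    then show "(f ^^ j) ((f ^^ length Us) x) \<in> Vs ! j"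
      by (auto simp: nth_append funpow_funpow add.commute dest!: spec[of _ "length Us + j"])
  next
    fix j assume r: ?r1 ?r2 and j: "j < length (Us @ Vs)"
    show "(f ^^ j) x \<in> (Us @ Vs) ! j"
    proof (cases "j < length Us")
      case False
      then have "(f ^^ (j - length Us)) ((f ^^ length Us) x) \<in> Vs ! (j - length Us)"
        using r(2) j by simp
      with False show ?thesis by (simp add: nth_append funpow_funpow)
    qed (use r in \<open>simp add: nth_append\<close>)
  qed
  then show ?thesis using funpow_mem by (auto simp: string_set_def)
qed

lemma open_cover_iterated_join:
  assumes "open_cover X \<U>"
  shows "open_cover X (iterated_join f X \<U> n)"
proof -
  have "x \<in> \<Union>(iterated_join f X \<U> n)" if "x \<in> X" for x
  proof -
    have "\<forall>j. \<exists>U. U \<in> \<U> \<and> (f ^^ j) x \<in> U"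
      using funpow_mem[OF that] assms by (fastforce simp: open_cover_def)
    then obtain U where "\<And>j. U j \<in> \<U>" "\<And>j. (f ^^ j) x \<in> U j" by metis
    then have "map U [0..<n] \<in> {Us \<in> lists \<U>. length Us = n}" "x \<in> string_set f X (map U [0..<n])"
      using that by (auto simp: string_set_def)
    then show ?thesis unfolding iterated_join_def by blast
  qed
  moreover have "openin (top_of_set X) V" if "V \<in> iterated_join f X \<U> n" for V
    using that openin_string_set[OF assms] by (auto simp: iterated_join_def)
  moreover have "V \<subseteq> X" if "V \<in> iterated_join f X \<U> n" for V
    using that by (auto simp: iterated_join_def string_set_def)
  ultimately show ?thesis unfolding open_cover_def by blast
qed

text \<open>Concatenating strings corresponds to intersecting a member of one join with the pullback
  under \<open>f ^^ m\<close> of a member of the other. The pairs from two minimal subcovers thus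
  give a subcover of the longer join.\<close>

lemma min_subcover_card_join_add:
  assumes "open_cover X \<U>"
  shows "min_subcover_card X (iterated_join f X \<U> (m + n)) \<le>
    min_subcover_card X (iterated_join f X \<U> m) * min_subcover_card X (iterated_join f X \<U> n)"
proof -
  obtain \<V> where \<V>: "\<V> \<subseteq> iterated_join f X \<U> m" "finite \<V>" "\<Union>\<V> = X"
    "card \<V> = min_subcover_card X (iterated_join f X \<U> m)"
    using min_subcover_card_attained[OF open_cover_iterated_join[OF assms]] by blast
  obtain \<W> where \<W>: "\<W> \<subseteq> iterated_join f X \<U> n" "finite \<W>" "\<Union>\<W> = X"
    "card \<W> = min_subcover_card X (iterated_join f X \<U> n)"
    using min_subcover_card_attained[OF open_cover_iterated_join[OF assms]] by blast
  let ?h = "\<lambda>(V, W). V \<inter> {x \<in> X. (f ^^ m) x \<in> W}"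
  have "?h (V, W) \<in> iterated_join f X \<U> (m + n)" if VW: "V \<in> \<V>" "W \<in> \<W>" for V W
  proof -
    have "V \<in> iterated_join f X \<U> m" "W \<in> iterated_join f X \<U> n" using VW \<V>(1) \<W>(1) by auto
    then obtain Us Vs where "Us \<in> lists \<U>" "length Us = m" "V = string_set f X Us"
      "Vs \<in> lists \<U>" "length Vs = n" "W = string_set f X Vs"
      unfolding iterated_join_def by (elim imageE CollectE conjE)
    then have "?h (V, W) = string_set f X (Us @ Vs)" "Us @ Vs \<in> {Us \<in> lists \<U>. length Us = m + n}"
      by (auto simp: string_set_append)
    then show ?thesis unfolding iterated_join_def by blast
  qed
  moreover have "\<Union>(?h ` (\<V> \<times> \<W>)) = X"
  proof
    show "X \<subseteq> \<Union>(?h ` (\<V> \<times> \<W>))"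
    proof
      fix x assume x: "x \<in> X"
      have "x \<in> \<Union>\<V>" "(f ^^ m) x \<in> \<Union>\<W>"
        using x funpow_mem[OF x, of m] by (simp_all only: \<V>(3) \<W>(3))
      then obtain V W where "V \<in> \<V>" "x \<in> V" "W \<in> \<W>" "(f ^^ m) x \<in> W" by (elim UnionE)
      then show "x \<in> \<Union>(?h ` (\<V> \<times> \<W>))" using x by auto
    qed
  qed auto
  ultimately have "min_subcover_card X (iterated_join f X \<U> (m + n)) \<le> card (?h ` (\<V> \<times> \<W>))"
    using \<V>(2) \<W>(2) by (intro min_subcover_card_le) auto
  also have "\<dots> \<le> card (\<V> \<times> \<W>)" using \<V>(2) \<W>(2) by (intro card_image_le) auto
  finally show ?thesis using \<V>(4) \<W>(4) by (simp add: card_cartesian_product)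
qed

text \<open>The logarithms are subadditive. Existence of the limit has to be established first, as
  \<open>lim\<close> gives no information about a divergent sequence.\<close>

lemma convergent_join_growth:
  assumes "open_cover X \<U>"
  shows "convergent (\<lambda>n. ln (real (min_subcover_card X (iterated_join f X \<U> n))) / real n)"
proof (rule convergent_subadditive_div)
  let ?a = "\<lambda>n. min_subcover_card X (iterated_join f X \<U> n)"
  have pos: "0 < ?a n" for n
    by (intro min_subcover_card_pos open_cover_iterated_join assms)
  show "0 \<le> ln (real (?a n))" for n using pos[of n] by (intro ln_ge_zero) simp
  fix m n
  have "ln (real (?a (m + n))) \<le> ln (real (?a m * ?a n))"
    using pos[of "m + n"] min_subcover_card_join_add[OF assms, of m n]
    by (subst ln_le_cancel_iff) (simp_all only: of_nat_0_less_iff of_nat_le_iff mult_pos_pos pos)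
  also have "\<dots> = ln (real (?a m)) + ln (real (?a n))"
    using pos by (simp add: ln_mult)
  finally show "ln (real (?a (m + n))) \<le> ln (real (?a m)) + ln (real (?a n))" .
qed

text \<open>The strings of \<open>string_cover_card_le\<close> supply a subcover with at most
  \<open>2 ^ (n + 2 * k)\<close> members, and \<open>2 * k\<close> disappears after division by
  \<open>n\<close>.\<close>

lemma join_growth_le:
  assumes "open_cover X \<U>"
  shows "lim (\<lambda>n. ereal (ln (real (min_subcover_card X (iterated_join f X \<U> n))) / real n)) \<le> ereal (ln 2)"
proof -
  let ?a = "\<lambda>n. min_subcover_card X (iterated_join f X \<U> n)"
  obtain L where L: "(\<lambda>n. ln (real (?a n)) / real n) \<longlonglongrightarrow> L"
    using convergent_join_growth[OF assms] by (auto simp: convergent_def)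
  obtain k where k: "\<And>n. \<exists>G. G \<subseteq> lists \<U> \<and> finite G \<and> card G \<le> 2 ^ (n + 2 * k) \<and>
    (\<forall>Us\<in>G. length Us = n) \<and> X \<subseteq> (\<Union>Us\<in>G. string_set f X Us)"
    using string_cover_card_le[OF assms] by blast
  have a_le: "?a n \<le> 2 ^ (n + 2 * k)" for n
  proof -
    obtain G where G: "G \<subseteq> lists \<U>" "finite G" "card G \<le> 2 ^ (n + 2 * k)"
      "\<forall>Us\<in>G. length Us = n" "X \<subseteq> (\<Union>Us\<in>G. string_set f X Us)"
      using k[of n] by blast
    have "\<Union>(string_set f X ` G) = X" using G(5) by (auto simp: string_set_def)
    then have "?a n \<le> card (string_set f X ` G)"
      using G by (intro min_subcover_card_le) (fastforce simp: iterated_join_def)+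
    also have "\<dots> \<le> card G" using G(2) by (rule card_image_le)
    finally show ?thesis using G(3) by simp
  qed
  have "ln (real (?a n)) / real n \<le> ln 2 + 2 * real k * ln 2 * (1 / real n)" if "n \<ge> 1" for n
  proof -
    have "0 < ?a n" by (intro min_subcover_card_pos open_cover_iterated_join assms)
    moreover have "real (?a n) \<le> 2 ^ (n + 2 * k)"
      using a_le[of n] by (metis of_nat_le_iff of_nat_numeral of_nat_power)
    ultimately have "ln (real (?a n)) \<le> ln (2 ^ (n + 2 * k))"
      by (subst ln_le_cancel_iff) auto
    also have "\<dots> = real (n + 2 * k) * ln 2" by (rule ln_realpow)
    finally show ?thesis using that by (simp add: field_simps)
  qed
  then have "\<forall>\<^sub>F n in sequentially. ln (real (?a n)) / real n \<le> ln 2 + 2 * real k * ln 2 * (1 / real n)"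
    unfolding eventually_sequentially by blast
  moreover have "(\<lambda>n. ln 2 + 2 * real k * ln 2 * (1 / real n)) \<longlonglongrightarrow> ln 2 + 2 * real k * ln 2 * 0"
    by (intro tendsto_intros lim_1_over_n)
  ultimately have "L \<le> ln 2" using tendsto_le[OF trivial_limit_sequentially _ L] by force
  moreover have "lim (\<lambda>n. ereal (ln (real (?a n)) / real n)) = ereal L"
    using L by (intro limI) simp
  ultimately show ?thesis by simp
qed

text \<open>All points of one member of the \<open>n\<close>-th join share their
  \<open>n\<close>-word, while all \<open>2 ^ n\<close> words occur. A subcover therefore has at
  least \<open>2 ^ n\<close> members.\<close>

lemma join_growth_symbol_cover:
  "ereal (ln 2) \<le>
    lim (\<lambda>n. ereal (ln (real (min_subcover_card X
      (iterated_join f X (range (\<lambda>b. {x \<in> X. sym x = b})) n))) / real n))"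
proof -
  let ?\<U> = "range (\<lambda>b. {x \<in> X. sym x = b})"
  let ?a = "\<lambda>n. min_subcover_card X (iterated_join f X ?\<U> n)"
  obtain L where L: "(\<lambda>n. ln (real (?a n)) / real n) \<longlonglongrightarrow> L"
    using convergent_join_growth[OF symbol_cover] by (auto simp: convergent_def)
  have a_ge: "2 ^ n \<le> ?a n" for n
  proof -
    obtain \<V> where \<V>: "\<V> \<subseteq> iterated_join f X ?\<U> n" "finite \<V>" "\<Union>\<V> = X" "card \<V> = ?a n"
      using min_subcover_card_attained[OF open_cover_iterated_join[OF symbol_cover]] by blast
    have const: "word n x = word n y" if V: "V \<in> \<V>" "x \<in> V" "y \<in> V" for V x y
    proof -
      obtain Us where "Us \<in> lists ?\<U>" "length Us = n" "V = string_set f X Us"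
        using V(1) \<V>(1) unfolding iterated_join_def by blast
      moreover from this have "\<exists>b. Us ! i = {x \<in> X. sym x = b}" if "i < n" for i
        using that by (auto simp: in_lists_conv_set dest: nth_mem)
      ultimately show ?thesis using V(2,3) by (fastforce simp: word_eq_iff string_set_def)
    qed
    have "{w :: bool list. set w \<subseteq> UNIV \<and> length w = n} \<subseteq> (\<lambda>V. word n (SOME x. x \<in> V)) ` \<V>"
    proof
      fix w :: "bool list" assume "w \<in> {w. set w \<subseteq> UNIV \<and> length w = n}"
      then obtain x where x: "x \<in> X" "word n x = w" using realize_word[of w n] by auto
      then obtain V where V: "V \<in> \<V>" "x \<in> V" using \<V>(3) by blast
      then have "word n (SOME x. x \<in> V) = w" using const[OF V(1) someI[of "\<lambda>x. x \<in> V"] V(2)] x by simp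
      then show "w \<in> (\<lambda>V. word n (SOME x. x \<in> V)) ` \<V>" using V(1) by blast
    qed
    from surj_card_le[OF \<V>(2) this] show ?thesis
      using card_lists_length_eq[of "UNIV :: bool set" n] \<V>(4) by simp
  qed
  have "ln 2 \<le> ln (real (?a n)) / real n" if "n \<ge> 1" for n
  proof -
    have "real n * ln 2 = ln (2 ^ n)" by (rule ln_realpow[symmetric])
    also have "real (2 ^ n) \<le> real (?a n)" using a_ge[of n] by (simp only: of_nat_le_iff)
    then have "ln (2 ^ n) \<le> ln (real (?a n))"
      by (intro ln_mono) auto
    finally show ?thesis using that by (simp add: field_simps)
  qed
  then have "\<forall>\<^sub>F n in sequentially. ln 2 \<le> ln (real (?a n)) / real n"
    unfolding eventually_sequentially by blast
  then have "ln 2 \<le> L" using tendsto_lowerbound[OF L] by simp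
  moreover have "lim (\<lambda>n. ereal (ln (real (?a n)) / real n)) = ereal L"
    using L by (intro limI) simp
  ultimately show ?thesis by simp
qed

lemma topological_entropy_eq: "topological_entropy f X = ereal (ln 2)"
  unfolding topological_entropy_def
proof (rule antisym)
  show "(SUP \<U>\<in>{\<U>. open_cover X \<U>}.
      lim (\<lambda>n. ereal (ln (real (min_subcover_card X (iterated_join f X \<U> n))) / real n))) \<le> ereal (ln 2)"
    by (intro SUP_least) (simp add: join_growth_le)
  show "ereal (ln 2) \<le> (SUP \<U>\<in>{\<U>. open_cover X \<U>}.
      lim (\<lambda>n. ereal (ln (real (min_subcover_card X (iterated_join f X \<U> n))) / real n)))"
    by (rule SUP_upper2[where i = "range (\<lambda>b. {x \<in> X. sym x = b})"])
      (use symbol_cover join_growth_symbol_cover in auto)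
qed


end


section \<open>Points with alternating majorities\<close>

context binary_coding
begin

definition birkhoff_sum :: "nat \<Rightarrow> 'a \<Rightarrow> int"
  where "birkhoff_sum n x = (\<Sum>i<n. spin (sym ((f ^^ i) x)))"

text \<open>\<epsilon> depends on the point because majority blocks of length \<open>k\<close>
  guarantee only \<open>1 / (2 * k)\<close>, and all \<open>k\<close> have to be accommodated. The
  times \<open>fact (Suc n)\<close> are strictly increasing from \<open>n = 0\<close> on, unlike
  \<open>fact n\<close>.\<close>

definition alternating_set :: "(nat \<Rightarrow> bool) \<Rightarrow> 'a set"
  where "alternating_set e = {x \<in> X. \<exists>\<epsilon>>0. \<forall>\<^sub>F n in sequentially.
    \<epsilon> * fact (Suc n) \<le> real_of_int (spin (e n) * birkhoff_sum (fact (Suc n)) x)}"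

lemma abs_spin [simp]: "\<bar>spin b\<bar> = 1"
  by (simp add: spin_def)

lemma alternating_set_subset: "alternating_set e \<subseteq> X"
  by (auto simp: alternating_set_def)

text \<open>A bounded error is eventually at most half of \<open>\<epsilon> * fact (Suc n)\<close>,
  so it only halves \<epsilon>. Forward invariance and density both rest on this.\<close>

lemma alternating_set_bounded_change:
  assumes x: "x \<in> alternating_set e" and y: "y \<in> X"
    and C: "\<And>n. \<bar>birkhoff_sum n x - birkhoff_sum n y\<bar> \<le> C"
  shows "y \<in> alternating_set e"
proof -
  obtain \<epsilon> where "0 < \<epsilon>" and \<epsilon>: "\<forall>\<^sub>F n in sequentially.
    \<epsilon> * fact (Suc n) \<le> real_of_int (spin (e n) * birkhoff_sum (fact (Suc n)) x)"
    using x by (auto simp: alternating_set_def)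
  obtain N :: nat where N: "2 * real_of_int C / \<epsilon> \<le> real N" using real_arch_simple by blast
  have "\<forall>\<^sub>F n in sequentially.
    \<epsilon> / 2 * fact (Suc n) \<le> real_of_int (spin (e n) * birkhoff_sum (fact (Suc n)) y)"
    using \<epsilon> eventually_ge_at_top[of N]
  proof eventually_elim
    case (elim n)
    have "real N \<le> real (fact (Suc n))"
      using elim(2) fact_ge_self[of "Suc n"] by (intro of_nat_mono) linarith
    then have "2 * real_of_int C / \<epsilon> \<le> fact (Suc n)" using N by (simp only: of_nat_fact)
    then have "real_of_int C \<le> \<epsilon> / 2 * fact (Suc n)" using \<open>0 < \<epsilon>\<close> by (simp add: field_simps)
    moreover have "spin (e n) * birkhoff_sum (fact (Suc n)) x \<le> spin (e n) * birkhoff_sum (fact (Suc n)) y + C"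
      using C[of "fact (Suc n)"] by (cases "e n") auto
    then have "real_of_int (spin (e n) * birkhoff_sum (fact (Suc n)) x) \<le>
        real_of_int (spin (e n) * birkhoff_sum (fact (Suc n)) y) + real_of_int C"
      by linarith
    ultimately show ?case using elim(1) by (simp add: field_simps)
  qed
  then show ?thesis using y \<open>0 < \<epsilon>\<close> unfolding alternating_set_def
    by (intro CollectI conjI exI[of _ "\<epsilon> / 2"]) auto
qed

text \<open>A shift drops the first term of a Birkhoff sum and appends one, a change of at most
  2.\<close>

lemma alternating_set_invariant: "f ` alternating_set e \<subseteq> alternating_set e"
proof
  fix y assume "y \<in> f ` alternating_set e"
  then obtain x where x: "x \<in> alternating_set e" "y = f x" by blast
  have "birkhoff_sum n y = birkhoff_sum (Suc n) x - spin (sym x)" for n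
    unfolding birkhoff_sum_def x(2) sum.lessThan_Suc_shift by (simp add: funpow_swap1)
  moreover have "birkhoff_sum (Suc n) x = birkhoff_sum n x + spin (sym ((f ^^ n) x))" for n
    by (simp add: birkhoff_sum_def)
  ultimately have "\<bar>birkhoff_sum n x - birkhoff_sum n y\<bar> \<le> 2" for n
    by (auto simp: spin_def)
  then show "y \<in> alternating_set e"
    using alternating_set_bounded_change[OF x(1)] x image_f alternating_set_subset by blast
qed

lemma birkhoff_sum_tail:
  assumes "\<And>i. m \<le> i \<Longrightarrow> sym ((f ^^ i) x) = sym ((f ^^ i) y)"
  shows "\<bar>birkhoff_sum n x - birkhoff_sum n y\<bar> \<le> 2 * int m"
proof -
  have "\<bar>birkhoff_sum n x - birkhoff_sum n y\<bar> \<le> (\<Sum>i<n. \<bar>spin (sym ((f ^^ i) x)) - spin (sym ((f ^^ i) y))\<bar>)"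
    unfolding birkhoff_sum_def sum_subtractf[symmetric] by (rule sum_abs)
  also have "\<dots> \<le> (\<Sum>i<n. if i < m then 2 else 0)"
    using assms by (intro sum_mono) (auto simp: spin_def not_less)
  also have "\<dots> = (\<Sum>i\<in>{..<n} \<inter> {..<m}. 2)" by (simp add: sum.If_cases lessThan_def)
  also have "\<dots> \<le> (\<Sum>i<m. 2)" by (intro sum_mono2) auto
  finally show ?thesis by (simp add: mult.commute)
qed

lemma birkhoff_sum_add: "birkhoff_sum (m + n) x = birkhoff_sum m x + (\<Sum>i<n. spin (sym ((f ^^ (m + i)) x)))"
  by (induction n) (simp_all add: birkhoff_sum_def add.assoc)

text \<open>
  The block \<open>j\<close> of length \<open>k\<close> is to have the majority \<open>e n\<close> when it lies between the times \<open>n!\<close> and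
  \<open>(n + 1)!\<close>; as \<open>n!\<close> is negligible against \<open>(n + 1)!\<close>, this determines the sign of the
  Birkhoff average at time \<open>(n + 1)!\<close>.
\<close>

lemma majority_set_subset_alternating_set:
  assumes "0 < k"
  shows "\<exists>g. majority_set k g \<subseteq> alternating_set e"
proof -
  \<comment> \<open>For \<open>j > 0\<close>, this is the \<open>n\<close> with
    \<open>fact n \<le> j * k < fact (Suc n)\<close>, the stage in which block \<open>j\<close>
    starts.\<close>
  define lev where "lev j = (LEAST n. j * k < fact (Suc n))" for j
  have lev: "lev j = n" if "fact n \<le> j * k" "j * k < fact (Suc n)" for j n
    unfolding lev_def
  proof (rule Least_equality)
    show "n \<le> m" if m: "j * k < fact (Suc m)" for m
    proof (rule ccontr)
      assume "\<not> n \<le> m"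
      then have "(fact (Suc m) :: nat) \<le> fact n" by (intro fact_mono) simp
      with m \<open>fact n \<le> j * k\<close> show False by linarith
    qed
  qed (fact that(2))
  have "x \<in> alternating_set e" if x: "x \<in> majority_set k (\<lambda>j. e (lev j))" for x
  proof -
    have block: "1 \<le> spin (e n) * (\<Sum>i<k. spin (sym ((f ^^ (j * k + i)) x)))"
      if "fact n \<le> j * k" "j * k < fact (Suc n)" for n j
    proof -
      have "block k j x \<in> majority_words k (e n)"
        using x lev[OF that] by (auto simp: majority_set_def)
      moreover have "sum_list (map spin (block k j x)) = (\<Sum>i<k. spin (sym ((f ^^ (j * k + i)) x)))"
        by (simp add: block_def comp_def interv_sum_list_conv_sum_set_nat atLeast0LessThan)
      ultimately show ?thesis by (simp add: majority_words_def)
    qed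
    have blocks: "int q \<le> spin (e n) * (birkhoff_sum ((p + q) * k) x - birkhoff_sum (p * k) x)"
      if "fact n \<le> p * k" "(p + q) * k \<le> fact (Suc n)" for n p q
      using that(2)
    proof (induction q)
      case (Suc q)
      have "(p + q) * k < fact (Suc n)" using Suc.prems \<open>0 < k\<close> by simp
      moreover have "fact n \<le> (p + q) * k" using that(1) by (simp add: algebra_simps)
      ultimately have "1 \<le> spin (e n) * (\<Sum>i<k. spin (sym ((f ^^ ((p + q) * k + i)) x)))"
        using block by blast
      moreover have "int q \<le> spin (e n) * (birkhoff_sum ((p + q) * k) x - birkhoff_sum (p * k) x)"
        using Suc by simp
      moreover have "birkhoff_sum ((p + Suc q) * k) x =
          birkhoff_sum ((p + q) * k) x + (\<Sum>i<k. spin (sym ((f ^^ ((p + q) * k + i)) x)))"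
        using birkhoff_sum_add[of "(p + q) * k" k x] by (simp add: algebra_simps)
      ultimately show ?case by (simp add: algebra_simps)
    qed simp
    have small: "\<bar>birkhoff_sum n x\<bar> \<le> int n" for n
      unfolding birkhoff_sum_def using sum_abs[of "\<lambda>i. spin (sym ((f ^^ i) x))" "{..<n}"] by simp
    have "\<forall>\<^sub>F n in sequentially.
      1 / (2 * real k) * fact (Suc n) \<le> real_of_int (spin (e n) * birkhoff_sum (fact (Suc n)) x)"
      \<comment> \<open>For such \<open>n\<close>, both \<open>fact n\<close> and
        \<open>fact (Suc n)\<close> are multiples of \<open>k\<close>; let
        \<open>fact n = p * k\<close>. The \<open>n * p\<close> blocks between them contribute at
        least 1 each, and the past costs at most \<open>p * k\<close>. What remains is at least half
        of \<open>Suc n * p\<close>, because \<open>n + 1 \<le> 2 * (n - k)\<close>.\<close>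
      using eventually_ge_at_top[of "2 * k + 2"]
    proof eventually_elim
      case (elim n)
      then have "k dvd fact n" using \<open>0 < k\<close> by (intro dvd_fact) auto
      then obtain p where p: "fact n = p * k" by (metis dvdE mult.commute)
      have p': "(fact (Suc n) :: nat) = (p + n * p) * k" using p by (simp add: algebra_simps)
      have "int (n * p) \<le> spin (e n) * (birkhoff_sum (fact (Suc n)) x - birkhoff_sum (fact n) x)"
        using blocks[of n p "n * p"] p p' by simp
      moreover have "\<bar>birkhoff_sum (fact n) x\<bar> \<le> int (p * k)" using small[of "fact n"] p by simp
      ultimately have "int (n * p) - int (p * k) \<le> spin (e n) * birkhoff_sum (fact (Suc n)) x"
        by (cases "e n") auto
      moreover have "int (Suc n * p) \<le> 2 * (int (n * p) - int (p * k))"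
      proof -
        have "Suc n + 2 * k \<le> 2 * n" using elim by simp
        then have "(Suc n + 2 * k) * p \<le> 2 * n * p" by (rule mult_le_mono1)
        then have "int ((Suc n + 2 * k) * p) \<le> int (2 * n * p)" by (simp only: of_nat_le_iff)
        then show ?thesis by (simp add: algebra_simps)
      qed
      ultimately have "int (Suc n * p) \<le> 2 * (spin (e n) * birkhoff_sum (fact (Suc n)) x)"
        by (meson mult_left_mono order_trans zero_le_numeral)
      then have "real_of_int (int (Suc n * p)) \<le> real_of_int (2 * (spin (e n) * birkhoff_sum (fact (Suc n)) x))"
        by (simp only: of_int_le_iff)
      moreover have "(fact (Suc n) :: real) = real (Suc n * p) * real k"
      proof -
        have "(fact (Suc n) :: real) = real (fact (Suc n))" by (rule of_nat_fact[symmetric])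
        also have "\<dots> = real (Suc n * p * k)" by (simp add: p' algebra_simps del: fact_Suc)
        finally show ?thesis by simp
      qed
      then have "1 / (2 * real k) * fact (Suc n) = real (Suc n * p) / 2"
        using \<open>0 < k\<close> by (simp del: fact_Suc)
      ultimately show ?case by (simp only:)
    qed
    then show ?thesis using x \<open>0 < k\<close> majority_set_subset unfolding alternating_set_def
      by (intro CollectI conjI exI[of _ "1 / (2 * real k)"]) auto
  qed
  then show ?thesis by blast
qed

lemma alternating_set_nonempty: "alternating_set e \<noteq> {}"
proof -
  obtain g where "majority_set 1 g \<subseteq> alternating_set e"
    using majority_set_subset_alternating_set[of 1 e] by auto
  moreover obtain x where "x \<in> majority_set 1 g"
    by (rule realize_blocks[of 1 0 "\<lambda>_. []" g]) auto
  ultimately show ?thesis by blast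
qed

text \<open>Let \<open>y\<close> be the \<open>k\<close>-th image of \<open>z\<close>. The first
  \<open>2 * k + 1\<close> symbols of \<open>z\<close>, followed by the tail of a point of the set,
  belong to a point \<open>w\<close> that is still in the set, since finitely many symbols have
  changed. Its \<open>k\<close>-th image is close to \<open>y\<close> and stays in the set by
  invariance.\<close>

lemma alternating_set_dense: "X \<subseteq> closure (alternating_set e)"
proof
  fix y assume y: "y \<in> X"
  show "y \<in> closure (alternating_set e)"
    unfolding closure_approachable
  proof (intro allI impI)
    fix d :: real assume "0 < d"
    then obtain k where k: "\<And>x y. x \<in> X \<Longrightarrow> y \<in> X \<Longrightarrow> \<forall>i\<le>2 * k. sym ((f ^^ i) x) = sym ((f ^^ i) y) \<Longrightarrow>
        dist ((f ^^ k) x) ((f ^^ k) y) < d"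
      using expansive by blast
    have "y \<in> (f ^^ k) ` X" using y by (simp only: funpow_image)
    then obtain z where z: "z \<in> X" "(f ^^ k) z = y" by (auto simp only: image_iff)
    obtain v where v: "v \<in> alternating_set e" using alternating_set_nonempty by blast
    obtain w where w: "w \<in> X"
      "\<And>i. sym ((f ^^ i) w) = (if i \<le> 2 * k then sym ((f ^^ i) z) else sym ((f ^^ i) v))"
      using realize[of "\<lambda>i. if i \<le> 2 * k then sym ((f ^^ i) z) else sym ((f ^^ i) v)"] by blast
    have "w \<in> alternating_set e"
      by (rule alternating_set_bounded_change[OF v w(1) birkhoff_sum_tail[of "Suc (2 * k)"]])
        (simp add: w(2))
    then have "(f ^^ k) w \<in> alternating_set e"
      using alternating_set_invariant[of e] by (induction k) (auto simp: image_subset_iff)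
    moreover have "dist ((f ^^ k) w) y < d" using k[OF w(1) z(1)] z(2) w(2) by simp
    ultimately show "\<exists>u\<in>alternating_set e. dist u y < d" by blast
  qed
qed

text \<open>Membership forces the Birkhoff sum at time \<open>fact (Suc n)\<close> to have the sign
  \<open>e n\<close> for all large \<open>n\<close>.\<close>

lemma alternating_set_disjoint:
  assumes "\<exists>\<^sub>F n in sequentially. e n \<noteq> e' n"
  shows "alternating_set e \<inter> alternating_set e' = {}"
proof (rule ccontr)
  assume "alternating_set e \<inter> alternating_set e' \<noteq> {}"
  then obtain x where "x \<in> alternating_set e" "x \<in> alternating_set e'" by blast
  then obtain \<epsilon> \<delta> where "0 < \<epsilon>" "0 < \<delta>" and
    ev: "\<forall>\<^sub>F n in sequentially. \<epsilon> * fact (Suc n) \<le> real_of_int (spin (e n) * birkhoff_sum (fact (Suc n)) x)"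
    "\<forall>\<^sub>F n in sequentially. \<delta> * fact (Suc n) \<le> real_of_int (spin (e' n) * birkhoff_sum (fact (Suc n)) x)"
    by (auto simp: alternating_set_def)
  have "\<forall>\<^sub>F n in sequentially. e n = e' n"
    using ev
  proof eventually_elim
    case (elim n)
    have "0 < \<epsilon> * fact (Suc n)" "0 < \<delta> * fact (Suc n)" using \<open>0 < \<epsilon>\<close> \<open>0 < \<delta>\<close> by simp_all
    with elim have "0 < real_of_int (spin (e n) * birkhoff_sum (fact (Suc n)) x)"
      "0 < real_of_int (spin (e' n) * birkhoff_sum (fact (Suc n)) x)" by linarith+
    then have "0 < spin (e n) * birkhoff_sum (fact (Suc n)) x" "0 < spin (e' n) * birkhoff_sum (fact (Suc n)) x"
      by (simp_all only: of_int_0_less_iff)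
    then show ?case by (cases "e n"; cases "e' n") auto
  qed
  with assms show False by (simp add: frequently_def)
qed

section \<open>Irregularity for the spin function, and measurability\<close>

lemma continuous_sym: "continuous_on X (\<lambda>x. real_of_int (spin (sym x)))"
proof -
  have "openin (top_of_set X) (X \<inter> (\<lambda>x. real_of_int (spin (sym x))) -` U)" for U
  proof -
    have "X \<inter> (\<lambda>x. real_of_int (spin (sym x))) -` U =
        (if 1 \<in> U then {x \<in> X. sym x = True} else {}) \<union> (if -1 \<in> U then {x \<in> X. sym x = False} else {})"
      by (auto simp: spin_def split: if_splits)
    then show ?thesis using openin_sym[of True] openin_sym[of False] by auto
  qed
  then show ?thesis by (simp add: continuous_on_open_gen[of _ X UNIV])
qed

text \<open>Along the times \<open>fact (Suc n)\<close> the averages are infinitely often at least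
  \<epsilon> and infinitely often at most -\<epsilon>.\<close>

lemma alternating_set_irregular:
  assumes e: "\<exists>\<^sub>F n in sequentially. e n" "\<exists>\<^sub>F n in sequentially. \<not> e n"
  shows "alternating_set e \<subseteq> irregular_set f X (\<lambda>x. real_of_int (spin (sym x)))"
proof
  fix x assume x: "x \<in> alternating_set e"
  then obtain \<epsilon> where "0 < \<epsilon>" and
    ev: "\<forall>\<^sub>F n in sequentially. \<epsilon> * fact (Suc n) \<le> real_of_int (spin (e n) * birkhoff_sum (fact (Suc n)) x)"
    by (auto simp: alternating_set_def)
  let ?u = "\<lambda>n. (\<Sum>j<n. real_of_int (spin (sym ((f ^^ j) x)))) / real n"
  have u: "?u n = real_of_int (birkhoff_sum n x) / real n" for n by (simp add: birkhoff_sum_def)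
  have "\<not> convergent ?u"
  proof
    assume "convergent ?u"
    then obtain L where "?u \<longlonglongrightarrow> L" by (auto simp: convergent_def)
    then have "(?u \<circ> (\<lambda>n. fact (Suc n))) \<longlonglongrightarrow> L"
      by (rule LIMSEQ_subseq_LIMSEQ) (auto simp: strict_mono_Suc_iff)
    then have L: "(\<lambda>n. ?u (fact (Suc n))) \<longlonglongrightarrow> L" by (simp add: comp_def)
    have ev': "\<forall>\<^sub>F n in sequentially. \<epsilon> \<le> real_of_int (spin (e n)) * ?u (fact (Suc n))"
      unfolding u using ev by eventually_elim (simp add: field_simps del: fact_Suc)
    have "\<epsilon> \<le> L"
    proof (rule ccontr)
      assume "\<not> \<epsilon> \<le> L"
      then have "\<forall>\<^sub>F n in sequentially. ?u (fact (Suc n)) < \<epsilon>" using order_tendstoD(2)[OF L] by simp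
      with ev' have "\<forall>\<^sub>F n in sequentially. \<not> e n" by eventually_elim (auto simp: not_less)
      with e(1) show False by (simp add: frequently_def)
    qed
    moreover have "L \<le> - \<epsilon>"
    proof (rule ccontr)
      assume "\<not> L \<le> - \<epsilon>"
      then have "\<forall>\<^sub>F n in sequentially. - \<epsilon> < ?u (fact (Suc n))" using order_tendstoD(1)[OF L] by simp
      with ev' have "\<forall>\<^sub>F n in sequentially. e n"
        by eventually_elim (rule ccontr, simp)
      with e(2) show False by (simp add: frequently_def)
    qed
    ultimately show False using \<open>0 < \<epsilon>\<close> by simp
  qed
  then show "x \<in> irregular_set f X (\<lambda>x. real_of_int (spin (sym x)))"
    using x alternating_set_subset by (auto simp: irregular_set_def)
qed

lemma alternating_set_measurable: "alternating_set e \<in> sets (restrict_space borel X)"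
proof -
  let ?R = "restrict_space borel X"
  have space: "space ?R = X" by (simp add: space_restrict_space)
  have S: "(\<lambda>x. real_of_int (birkhoff_sum n x)) \<in> borel_measurable ?R" for n
  proof (rule borel_measurable_continuous_on_restrict)
    have "continuous_on X (\<lambda>x. real_of_int (spin (sym ((f ^^ i) x))))" for i
      using continuous_on_compose[OF continuous_funpow[of i]] continuous_sym
      by (simp add: funpow_image comp_def)
    then show "continuous_on X (\<lambda>x. real_of_int (birkhoff_sum n x))"
      unfolding birkhoff_sum_def of_int_sum by (intro continuous_on_sum)
  qed
  \<comment> \<open>Replacing \<epsilon> by \<open>1 / real (Suc q)\<close> turns the quantifier
    over the reals into a countable union.\<close>
  have "alternating_set e = (\<Union>q. \<Union>N. \<Inter>n\<in>{N..}. {x \<in> space ?R.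
      1 / real (Suc q) * fact (Suc n) \<le> real_of_int (spin (e n)) * real_of_int (birkhoff_sum (fact (Suc n)) x)})"
    (is "_ = ?A")
  proof
    show "?A \<subseteq> alternating_set e"
    proof
      fix x assume "x \<in> ?A"
      then obtain q N where *: "\<And>n. N \<le> n \<Longrightarrow> x \<in> X \<and>
        1 / real (Suc q) * fact (Suc n) \<le> real_of_int (spin (e n)) * real_of_int (birkhoff_sum (fact (Suc n)) x)"
        unfolding space by blast
      then show "x \<in> alternating_set e"
        unfolding alternating_set_def eventually_sequentially of_int_mult
        using *[of N] by (intro CollectI conjI exI[of _ "1 / real (Suc q)"]) (auto simp del: fact_Suc)
    qed
    show "alternating_set e \<subseteq> ?A"
    proof
      fix x assume "x \<in> alternating_set e"
      then obtain \<epsilon> N where x: "x \<in> X" "0 < \<epsilon>" and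
        N: "\<And>n. N \<le> n \<Longrightarrow> \<epsilon> * fact (Suc n) \<le> real_of_int (spin (e n)) * real_of_int (birkhoff_sum (fact (Suc n)) x)"
        unfolding alternating_set_def eventually_sequentially of_int_mult by blast
      obtain q where q: "1 / real (Suc q) < \<epsilon>" using nat_approx_posE[OF x(2)] by blast
      have "1 / real (Suc q) * fact (Suc n) \<le> real_of_int (spin (e n)) * real_of_int (birkhoff_sum (fact (Suc n)) x)"
        if "N \<le> n" for n
      proof -
        have "1 / real (Suc q) * fact (Suc n) \<le> \<epsilon> * fact (Suc n)"
          using q by (intro mult_right_mono) auto
        also note N[OF that]
        finally show ?thesis .
      qed
      then show "x \<in> ?A" unfolding space using x(1) by blast
    qed
  qed
  also have "?A \<in> sets ?R"
  proof -
    have *: "{x \<in> space ?R. c \<le> a * real_of_int (birkhoff_sum n x)} \<in> sets ?R" for c a n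
      by (intro borel_measurable_le borel_measurable_const borel_measurable_times S)
    show ?thesis
      by (intro sets.countable_UN sets.countable_INT' image_subsetI *) simp_all
  qed
  finally show ?thesis .
qed

theorem exists_disjoint_irregular_family:
  "\<exists>\<N>. uncountable \<N> \<and>
    (\<forall>N\<in>\<N>. N \<in> sets (restrict_space borel X)) \<and>
    (\<exists>\<phi> :: 'a \<Rightarrow> real. continuous_on X \<phi> \<and> (\<forall>N\<in>\<N>. N \<subseteq> irregular_set f X \<phi>)) \<and>
    (\<forall>N\<in>\<N>. X \<subseteq> closure N \<and> f ` N \<subseteq> N) \<and>
    (\<forall>N\<in>\<N>. \<forall>N'\<in>\<N>. N \<noteq> N' \<longrightarrow> N \<inter> N' = {}) \<and>
    (\<forall>N\<in>\<N>. subset_entropy f X N = topological_entropy f X)"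
proof -
  obtain E :: "(nat \<Rightarrow> bool) set" where "uncountable E" and
    E: "\<forall>e\<in>E. (\<exists>\<^sub>F n in sequentially. e n) \<and> (\<exists>\<^sub>F n in sequentially. \<not> e n)"
    "\<forall>e\<in>E. \<forall>e'\<in>E. e \<noteq> e' \<longrightarrow> (\<exists>\<^sub>F n in sequentially. e n \<noteq> e' n)"
    using uncountable_frequently_different by metis
  have disj: "alternating_set e \<inter> alternating_set e' = {}" if "e \<in> E" "e' \<in> E" "e \<noteq> e'" for e e'
    using E(2) that by (intro alternating_set_disjoint) blast
  \<comment> \<open>Nonempty, pairwise disjoint sets are distinct, so uncountability passes from
    \<open>E\<close> to the family.\<close>
  have "inj_on alternating_set E"
  proof (rule inj_onI, rule ccontr)
    fix e e' assume *: "e \<in> E" "e' \<in> E" "alternating_set e = alternating_set e'" "e \<noteq> e'"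
    then show False using disj[OF *(1,2,4)] alternating_set_nonempty[of e'] by simp
  qed
  then have unc: "uncountable (alternating_set ` E)" using \<open>uncountable E\<close> countable_image_inj_on by blast
  have ent: "subset_entropy f X (alternating_set e) = topological_entropy f X" for e
    unfolding topological_entropy_eq
    by (rule subset_entropy_eq[OF alternating_set_subset majority_set_subset_alternating_set])
  have irr: "alternating_set e \<subseteq> irregular_set f X (\<lambda>x. real_of_int (spin (sym x)))" if "e \<in> E" for e
    using E(1) that by (intro alternating_set_irregular) blast+
  have "\<forall>N\<in>alternating_set ` E. \<forall>N'\<in>alternating_set ` E. N \<noteq> N' \<longrightarrow> N \<inter> N' = {}"
  proof (intro ballI impI)
    fix N N' assume "N \<in> alternating_set ` E" "N' \<in> alternating_set ` E" "N \<noteq> N'"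
    then obtain e e' where "e \<in> E" "e' \<in> E" "N = alternating_set e" "N' = alternating_set e'" "e \<noteq> e'"
      by auto
    then show "N \<inter> N' = {}" by (simp add: disj)
  qed
  moreover have "\<exists>\<phi> :: 'a \<Rightarrow> real. continuous_on X \<phi> \<and> (\<forall>N\<in>alternating_set ` E. N \<subseteq> irregular_set f X \<phi>)"
    by (rule exI[of _ "\<lambda>x. real_of_int (spin (sym x))"]) (simp add: continuous_sym irr)
  ultimately show ?thesis
    by (intro exI[of _ "alternating_set ` E"])
      (simp add: unc ent alternating_set_measurable alternating_set_dense alternating_set_invariant)
qed

end

section \<open>Coding of the horseshoe\<close>

lemma maximal_invariant_set_image: "F ` maximal_invariant_set F Q = maximal_invariant_set F Q"
proof
  show "F ` maximal_invariant_set F Q \<subseteq> maximal_invariant_set F Q"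
    unfolding maximal_invariant_set_def by blast
  show "maximal_invariant_set F Q \<subseteq> F ` maximal_invariant_set F Q"
    unfolding maximal_invariant_set_def
  proof
    fix x assume "x \<in> \<Union>{A. A \<subseteq> Q \<and> F ` A = A}"
    then obtain A where A: "x \<in> A" "A \<subseteq> Q" "F ` A = A" by auto
    then have "A \<subseteq> \<Union>{A. A \<subseteq> Q \<and> F ` A = A}" by auto
    then have "F ` A \<subseteq> F ` \<Union>{A. A \<subseteq> Q \<and> F ` A = A}" by (rule image_mono)
    with A show "x \<in> F ` \<Union>{A. A \<subseteq> Q \<and> F ` A = A}" by auto
  qed
qed

lemma maximal_invariant_set_subset: "maximal_invariant_set F Q \<subseteq> Q"
  by (auto simp: maximal_invariant_set_def)

lemma maximal_invariant_set_greatest: "A \<subseteq> Q \<Longrightarrow> F ` A = A \<Longrightarrow> A \<subseteq> maximal_invariant_set F Q"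
  by (auto simp: maximal_invariant_set_def)

text \<open>The closure of the set is again invariant: its image is compact and contains the set,
  and continuity keeps the image inside the closure. Maximality then makes the set closed.\<close>

lemma compact_maximal_invariant_set:
  fixes F :: "'a::euclidean_space \<Rightarrow> 'a"
  assumes "compact Q" "continuous_on Q F"
  shows "compact (maximal_invariant_set F Q)"
proof -
  let ?X = "maximal_invariant_set F Q"
  have sub: "closure ?X \<subseteq> Q"
    using maximal_invariant_set_subset compact_imp_closed[OF assms(1)] by (rule closure_minimal)
  then have cpt: "compact (closure ?X)"
    using assms(1) by (meson bounded_subset closed_closure compact_eq_bounded_closed)
  have cont: "continuous_on (closure ?X) F" using assms(2) sub by (rule continuous_on_subset)
  have "F ` closure ?X = closure ?X"
  proof
    show "F ` closure ?X \<subseteq> closure ?X"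
      by (rule image_closure_subset[OF cont closed_closure])
        (simp add: maximal_invariant_set_image closure_subset)
    have "closed (F ` closure ?X)" by (intro compact_imp_closed compact_continuous_image cont cpt)
    moreover have "?X \<subseteq> F ` closure ?X"
      using maximal_invariant_set_image[of F Q] closure_subset[of ?X] by blast
    ultimately show "closure ?X \<subseteq> F ` closure ?X" by (intro closure_minimal)
  qed
  with sub have "closure ?X \<subseteq> ?X" by (rule maximal_invariant_set_greatest)
  then have "closure ?X = ?X" using closure_subset by blast
  with cpt show ?thesis by simp
qed

text \<open>Both strips are indexed by \<open>bool\<close>, so that a symbol directly selects its
  strip and its affine branch.\<close>

locale affine_horseshoe =
  fixes F :: "real \<times> real \<Rightarrow> real \<times> real" and a b c d l m p q :: "bool \<Rightarrow> real"
  assumes continuous_F: "continuous_on unit_square F" and inj_F: "inj_on F unit_square"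
    and strips: "\<And>s. c s < d s" "\<And>s. {a s..b s} \<subseteq> {0..1}"
      "{c True..d True} \<inter> {c False..d False} = {}"
    and image_strip: "\<And>s. F ` ({0..1} \<times> {a s..b s}) = {c s..d s} \<times> {0..1}"
    and hyperbolic: "\<And>s. \<bar>l s\<bar> < 1" "\<And>s. 1 < \<bar>m s\<bar>"
    and affine: "\<And>s x y. x \<in> {0..1} \<Longrightarrow> y \<in> {a s..b s} \<Longrightarrow> F (x, y) = (p s + l s * x, q s + m s * y)"
    and image_square: "unit_square \<inter> F ` unit_square = (\<Union>s. {c s..d s} \<times> {0..1})"
begin

abbreviation "\<Lambda> \<equiv> maximal_invariant_set F unit_square"

section \<open>Expansivity of the coding\<close>

definition strip :: "bool \<Rightarrow> (real \<times> real) set"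
  where "strip s = {0..1} \<times> {a s..b s}"

definition coding :: "real \<times> real \<Rightarrow> bool"
  where "coding z \<longleftrightarrow> z \<in> strip True"

lemma image_strip_eq: "F ` strip s = {c s..d s} \<times> {0..1}"
  unfolding strip_def by (rule image_strip)

lemma strip_subset: "strip s \<subseteq> unit_square"
  unfolding strip_def by (intro Sigma_mono strips(2) order_refl)

lemma strips_disjoint: "strip True \<inter> strip False = {}"
proof (rule ccontr)
  assume "strip True \<inter> strip False \<noteq> {}"
  then obtain z where "z \<in> strip True" "z \<in> strip False" by blast
  then have "F z \<in> {c True..d True} \<times> {0..1}" "F z \<in> {c False..d False} \<times> {0..1}"
    unfolding image_strip_eq[symmetric] by blast+
  then show False using strips(3) by auto
qed

text \<open>The image of \<open>z\<close> lies in the square and in the image of the square, hence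
  in a vertical strip; injectivity brings this back to a horizontal strip.\<close>

lemma in_strip:
  assumes "z \<in> \<Lambda>"
  shows "z \<in> strip s \<longleftrightarrow> coding z = s"
proof -
  have z: "z \<in> unit_square" by (rule subsetD[OF maximal_invariant_set_subset assms])
  have "F z \<in> \<Lambda>" using imageI[OF assms, of F] by (simp only: maximal_invariant_set_image)
  then have "F z \<in> unit_square" by (rule subsetD[OF maximal_invariant_set_subset])
  with z have "F z \<in> unit_square \<inter> F ` unit_square" by blast
  then obtain t where "F z \<in> {c t..d t} \<times> {0..1}" unfolding image_square by (rule UN_E)
  then have "F z \<in> F ` strip t" by (simp only: image_strip_eq)
  then have "z \<in> strip t" using inj_F z strip_subset[of t] by (auto simp only: inj_on_image_mem_iff)
  moreover have "z \<notin> strip (\<not> t)"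
    using \<open>z \<in> strip t\<close> strips_disjoint by (cases t) (auto simp only: disjoint_iff simp_thms)
  ultimately show ?thesis unfolding coding_def by (cases s; cases t) simp_all
qed

text \<open>One factor for both directions: horizontal contraction forwards and vertical contraction
  backwards.\<close>

definition rate :: real
  where "rate = Max {\<bar>l True\<bar>, \<bar>l False\<bar>, 1 / \<bar>m True\<bar>, 1 / \<bar>m False\<bar>}"

lemma rate: "0 < rate" "rate < 1" "\<bar>l s\<bar> \<le> rate" "1 / \<bar>m s\<bar> \<le> rate"
proof -
  have "0 < 1 / \<bar>m True\<bar>" using hyperbolic(2)[of True] by simp
  then show "0 < rate" unfolding rate_def by (subst Max_gr_iff) auto
  show "rate < 1" unfolding rate_def using hyperbolic[of True] hyperbolic[of False]
    by (subst Max_less_iff) auto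
  show "\<bar>l s\<bar> \<le> rate" "1 / \<bar>m s\<bar> \<le> rate"
    unfolding rate_def by (cases s; intro Max_ge; simp)+
qed

lemma one_step:
  assumes "z \<in> \<Lambda>" "w \<in> \<Lambda>" "coding z = coding w"
  shows "\<bar>fst (F z) - fst (F w)\<bar> \<le> rate * \<bar>fst z - fst w\<bar>"
    and "\<bar>snd z - snd w\<bar> \<le> rate * \<bar>snd (F z) - snd (F w)\<bar>"
proof -
  let ?s = "coding z"
  have "z \<in> strip ?s" "w \<in> strip ?s" using in_strip assms by simp_all
  then have F: "F z = (p ?s + l ?s * fst z, q ?s + m ?s * snd z)"
    "F w = (p ?s + l ?s * fst w, q ?s + m ?s * snd w)"
    using affine[of "fst z" "snd z" ?s] affine[of "fst w" "snd w" ?s] by (auto simp: mem_Times_iff strip_def)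
  have "\<bar>fst (F z) - fst (F w)\<bar> = \<bar>l ?s\<bar> * \<bar>fst z - fst w\<bar>"
    unfolding F by (simp add: abs_mult[symmetric] right_diff_distrib)
  also have "\<dots> \<le> rate * \<bar>fst z - fst w\<bar>" by (intro mult_right_mono rate) simp
  finally show "\<bar>fst (F z) - fst (F w)\<bar> \<le> rate * \<bar>fst z - fst w\<bar>" .
  have "\<bar>snd (F z) - snd (F w)\<bar> = \<bar>m ?s\<bar> * \<bar>snd z - snd w\<bar>"
    unfolding F by (simp add: abs_mult[symmetric] right_diff_distrib)
  then have "\<bar>snd z - snd w\<bar> = 1 / \<bar>m ?s\<bar> * \<bar>snd (F z) - snd (F w)\<bar>"
    using hyperbolic(2)[of ?s] by auto
  also have "\<dots> \<le> rate * \<bar>snd (F z) - snd (F w)\<bar>" by (intro mult_right_mono rate) simp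
  finally show "\<bar>snd z - snd w\<bar> \<le> rate * \<bar>snd (F z) - snd (F w)\<bar>" .
qed

lemma iterate_mem: "z \<in> \<Lambda> \<Longrightarrow> (F ^^ n) z \<in> \<Lambda>"
  using maximal_invariant_set_image[of F unit_square] by (induction n) auto

lemma mem_bounds: "z \<in> \<Lambda> \<Longrightarrow> w \<in> \<Lambda> \<Longrightarrow> \<bar>fst z - fst w\<bar> \<le> 1 \<and> \<bar>snd z - snd w\<bar> \<le> 1"
proof -
  assume "z \<in> \<Lambda>" "w \<in> \<Lambda>"
  then have "z \<in> unit_square" "w \<in> unit_square" by (simp_all only: subsetD[OF maximal_invariant_set_subset])
  then show ?thesis by (auto simp: mem_Times_iff)
qed

lemma iterate_bounds:
  assumes "z \<in> \<Lambda>" "w \<in> \<Lambda>" "\<And>i. i < n \<Longrightarrow> coding ((F ^^ i) z) = coding ((F ^^ i) w)"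
  shows "\<bar>fst ((F ^^ n) z) - fst ((F ^^ n) w)\<bar> \<le> rate ^ n"
    and "\<bar>snd z - snd w\<bar> \<le> rate ^ n"
proof -
  \<comment> \<open>The vertical estimate has to keep the difference at time \<open>n\<close> as a
    factor during the induction; only afterwards is it bounded by 1.\<close>
  have "\<bar>fst ((F ^^ n) z) - fst ((F ^^ n) w)\<bar> \<le> rate ^ n \<and>
      \<bar>snd z - snd w\<bar> \<le> rate ^ n * \<bar>snd ((F ^^ n) z) - snd ((F ^^ n) w)\<bar>"
    using assms(3)
  proof (induction n)
    case 0
    then show ?case using mem_bounds[OF assms(1,2)] by simp
  next
    case (Suc n)
    let ?z = "(F ^^ n) z" and ?w = "(F ^^ n) w"
    note step = one_step[OF iterate_mem[OF assms(1)] iterate_mem[OF assms(2)] Suc.prems[of n]]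
    have IH: "\<bar>fst ?z - fst ?w\<bar> \<le> rate ^ n" "\<bar>snd z - snd w\<bar> \<le> rate ^ n * \<bar>snd ?z - snd ?w\<bar>"
      using Suc by simp_all
    have "rate * \<bar>fst ?z - fst ?w\<bar> \<le> rate * rate ^ n"
      using IH(1) rate(1) by (intro mult_left_mono) auto
    moreover have "rate ^ n * \<bar>snd ?z - snd ?w\<bar> \<le> rate ^ n * (rate * \<bar>snd (F ?z) - snd (F ?w)\<bar>)"
      using step(2) rate(1) by (intro mult_left_mono) auto
    ultimately show ?case using step(1) IH(2) by (simp add: mult.assoc mult.left_commute)
  qed
  moreover have "rate ^ n * \<bar>snd ((F ^^ n) z) - snd ((F ^^ n) w)\<bar> \<le> rate ^ n * 1"
    using mem_bounds[OF iterate_mem[OF assms(1)] iterate_mem[OF assms(2)]] rate(1)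
    by (intro mult_left_mono) auto
  ultimately show "\<bar>fst ((F ^^ n) z) - fst ((F ^^ n) w)\<bar> \<le> rate ^ n" "\<bar>snd z - snd w\<bar> \<le> rate ^ n"
    by simp_all
qed

text \<open>At the middle time, the past symbols bound the horizontal distance and the future ones
  the vertical distance, each below \<open>e / 2\<close>.\<close>

lemma coding_expansive:
  assumes "0 < e"
  shows "\<exists>k. \<forall>z\<in>\<Lambda>. \<forall>w\<in>\<Lambda>. (\<forall>i\<le>2 * k. coding ((F ^^ i) z) = coding ((F ^^ i) w)) \<longrightarrow>
    dist ((F ^^ k) z) ((F ^^ k) w) < e"
proof -
  obtain k where k: "rate ^ k < e / 2"
    using real_arch_pow_inv[of "e / 2" rate] assms rate by auto
  show ?thesis
  proof (intro exI ballI impI)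
    fix z w assume zw: "z \<in> \<Lambda>" "w \<in> \<Lambda>" and eq: "\<forall>i\<le>2 * k. coding ((F ^^ i) z) = coding ((F ^^ i) w)"
    let ?z = "(F ^^ k) z" and ?w = "(F ^^ k) w"
    have "coding ((F ^^ i) z) = coding ((F ^^ i) w)" if "i < k" for i
      using eq that by simp
    then have x: "\<bar>fst ?z - fst ?w\<bar> \<le> rate ^ k" by (rule iterate_bounds(1)[OF zw])
    have "coding ((F ^^ i) ?z) = coding ((F ^^ i) ?w)" if "i < k" for i
      using eq that by (simp add: funpow_funpow)
    then have y: "\<bar>snd ?z - snd ?w\<bar> \<le> rate ^ k"
      by (rule iterate_bounds(2)[OF iterate_mem[OF zw(1)] iterate_mem[OF zw(2)]])
    have "dist ?z ?w \<le> \<bar>fst ?z - fst ?w\<bar> + \<bar>snd ?z - snd ?w\<bar>"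
      unfolding dist_prod_def dist_real_def using sqrt_sum_squares_le_sum_abs by simp
    then show "dist ?z ?w < e" using x y k by simp
  qed
qed

section \<open>Points with a prescribed itinerary\<close>

definition contraction :: "bool \<Rightarrow> real \<Rightarrow> real"
  where "contraction s x = p s + l s * x"

definition inverse_branch :: "bool \<Rightarrow> real \<Rightarrow> real"
  where "inverse_branch s y = (y - q s) / m s"

lemma strip_nonempty: "a s \<le> b s"
proof (rule ccontr)
  assume "\<not> a s \<le> b s"
  then have "{c s..d s} \<times> {0..1::real} = {}" using image_strip[of s] by simp
  then show False using strips(1)[of s] by (simp add: less_le_not_le)
qed

lemma vertical_strip_subset: "{c s..d s} \<subseteq> {0..1}"
proof
  fix x assume "x \<in> {c s..d s}"
  then have "(x, 0) \<in> unit_square \<inter> F ` unit_square" unfolding image_square by auto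
  then show "x \<in> {0..1}" by auto
qed

lemma contraction_mem: "x \<in> {0..1} \<Longrightarrow> contraction s x \<in> {0..1}"
proof -
  assume x: "x \<in> {0..1}"
  then have "F (x, a s) \<in> F ` strip s" using strip_nonempty by (intro imageI) (auto simp: strip_def)
  then have "F (x, a s) \<in> {c s..d s} \<times> {0..1}" by (simp only: image_strip_eq)
  then have "contraction s x \<in> {c s..d s}"
    using affine[OF x, of "a s" s] strip_nonempty by (simp add: contraction_def)
  then show ?thesis using vertical_strip_subset by blast
qed

lemma inverse_branch_mem: "y \<in> {0..1} \<Longrightarrow> inverse_branch s y \<in> {a s..b s}"
proof -
  assume "y \<in> {0..1}"
  then have "(c s, y) \<in> F ` strip s" using strips(1)[of s] by (simp only: image_strip_eq) auto
  then obtain x' y' where x': "x' \<in> {0..1}" and y': "y' \<in> {a s..b s}" and F: "F (x', y') = (c s, y)"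
    unfolding strip_def by (elim imageE SigmaE) auto
  have "y = q s + m s * y'" using affine[OF x' y'] F by simp
  then have "inverse_branch s y = y'" using hyperbolic(2)[of s] by (auto simp: inverse_branch_def)
  then show ?thesis using y' by simp
qed

text \<open>The height 0 is pulled back through the inverse branches named by the first
  \<open>n\<close> terms of \<open>t\<close>, with the branch of \<open>t 0\<close> outermost. The
  limit is the height at which the itinerary \<open>t\<close> is followed.\<close>

primrec approx :: "nat \<Rightarrow> (nat \<Rightarrow> bool) \<Rightarrow> real" where
  "approx 0 t = 0"
| "approx (Suc n) t = inverse_branch (t 0) (approx n (\<lambda>i. t (Suc i)))"

lemma approx_mem: "approx n t \<in> {0..1}"
proof (induction n arbitrary: t)
  case (Suc n)
  then show ?case using inverse_branch_mem strips(2)[of "t 0"] by (simp only: approx.simps) blast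
qed simp

text \<open>Both terms arise through the same \<open>n\<close> inverse branches from points of the
  unit interval, and each branch contracts at least by \<open>rate\<close>.\<close>

lemma approx_diff: "\<bar>approx (Suc n) t - approx n t\<bar> \<le> rate ^ n"
proof (induction n arbitrary: t)
  case 0
  then show ?case using approx_mem[of "Suc 0" t] by simp
next
  case (Suc n)
  let ?t = "\<lambda>i. t (Suc i)"
  have "approx (Suc (Suc n)) t - approx (Suc n) t = (approx (Suc n) ?t - approx n ?t) / m (t 0)"
    by (simp add: inverse_branch_def diff_divide_distrib)
  then have "\<bar>approx (Suc (Suc n)) t - approx (Suc n) t\<bar> = 1 / \<bar>m (t 0)\<bar> * \<bar>approx (Suc n) ?t - approx n ?t\<bar>"
    by (simp only: abs_divide) simp
  also have "\<dots> \<le> rate * rate ^ n"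
    using Suc[of ?t] rate by (intro mult_mono) auto
  finally show ?case by simp
qed

lemma approx_convergent: "convergent (\<lambda>n. approx n t)"
proof -
  have "summable (\<lambda>n. approx (Suc n) t - approx n t)"
    by (rule summable_comparison_test[OF _ summable_geometric[of rate]])
      (use rate approx_diff in auto)
  then have "convergent (\<lambda>n. \<Sum>i<n. approx (Suc i) t - approx i t)"
    by (simp only: summable_iff_convergent)
  also have "(\<lambda>n. \<Sum>i<n. approx (Suc i) t - approx i t) = (\<lambda>n. approx n t)"
    using sum_lessThan_telescope[of "\<lambda>n. approx n t"] by (simp only: approx.simps(1) diff_zero)
  finally show ?thesis .
qed

definition height :: "(nat \<Rightarrow> bool) \<Rightarrow> real"
  where "height t = lim (\<lambda>n. approx n t)"

lemma approx_tendsto: "(\<lambda>n. approx n t) \<longlonglongrightarrow> height t"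
  unfolding height_def using approx_convergent by (simp only: convergent_LIMSEQ_iff)

lemma height_mem: "height t \<in> {0..1}"
  by (rule closed_sequentially[OF _ _ approx_tendsto]) (simp_all only: closed_atLeastAtMost approx_mem)

lemma height_eq: "height t = inverse_branch (t 0) (height (\<lambda>i. t (Suc i)))"
proof (rule LIMSEQ_unique)
  show "(\<lambda>n. approx (Suc n) t) \<longlonglongrightarrow> height t" by (rule LIMSEQ_Suc[OF approx_tendsto])
  show "(\<lambda>n. approx (Suc n) t) \<longlonglongrightarrow> inverse_branch (t 0) (height (\<lambda>i. t (Suc i)))"
    unfolding approx.simps inverse_branch_def
    using hyperbolic(2)[of "t 0"] by (intro tendsto_intros approx_tendsto) auto
qed

lemma height_in_strip: "height t \<in> {a (t 0)..b (t 0)}"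
  using inverse_branch_mem[OF height_mem] height_eq[of t] by simp

lemma F_height:
  assumes "x \<in> {0..1}"
  shows "F (x, height t) = (contraction (t 0) x, height (\<lambda>i. t (Suc i)))"
proof -
  have "q (t 0) + m (t 0) * height t = height (\<lambda>i. t (Suc i))"
    using height_eq[of t] hyperbolic(2)[of "t 0"] by (auto simp: inverse_branch_def)
  then show ?thesis using affine[OF assms height_in_strip] by (simp add: contraction_def)
qed

text \<open>
  Starting from the fixed point of one contraction makes the orbit under the semigroup of
  contractions backward invariant: \<open>base = contraction True base\<close>.
\<close>

definition base :: real
  where "base = p True / (1 - l True)"

definition orbit :: "real set"
  where "orbit = range (\<lambda>w. foldr contraction w base)"

lemma base_mem: "base \<in> {0..1}"
proof -
  have "0 \<le> p True" "p True + l True \<le> 1"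
    using contraction_mem[of 0 True] contraction_mem[of 1 True] by (simp_all add: contraction_def)
  moreover have "l True < 1" using hyperbolic(1)[of True] by simp
  ultimately show ?thesis by (simp add: base_def field_simps)
qed

lemma base_fixed: "contraction True base = base"
  using hyperbolic(1)[of True] by (simp add: base_def contraction_def field_simps)

lemma orbit_subset: "orbit \<subseteq> {0..1}"
proof -
  have "foldr contraction w base \<in> {0..1}" for w
    by (induction w) (simp_all only: foldr.simps id_apply comp_apply base_mem contraction_mem)
  then show ?thesis unfolding orbit_def by blast
qed

lemma contraction_orbit: "x \<in> orbit \<Longrightarrow> contraction s x \<in> orbit"
proof -
  assume "x \<in> orbit"
  then obtain w where "x = foldr contraction w base" by (auto simp: orbit_def)
  then have "contraction s x = foldr contraction (s # w) base" by simp
  then show ?thesis unfolding orbit_def by blast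
qed

lemma orbit_preimage:
  assumes "x \<in> orbit"
  obtains s y where "y \<in> orbit" "x = contraction s y"
proof -
  obtain w where w: "x = foldr contraction w base" using assms by (auto simp: orbit_def)
  show ?thesis
  proof (cases w)
    case Nil
    then show ?thesis using that[OF assms, of True] w base_fixed by simp
  next
    case (Cons s w')
    then show ?thesis using that[of "foldr contraction w' base" s] w by (auto simp: orbit_def)
  qed
qed

text \<open>Preimages are found by prepending a symbol: if \<open>x = contraction s y\<close>, then
  \<open>y\<close> with the sequence \<open>case_nat s t\<close> is mapped to \<open>x\<close> with
  \<open>t\<close>. The product is thus mapped onto itself, and maximality applies.\<close>

lemma orbit_heights_subset: "orbit \<times> range height \<subseteq> \<Lambda>"
proof (rule maximal_invariant_set_greatest)
  show "orbit \<times> range height \<subseteq> unit_square"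
    using orbit_subset height_mem by blast
  show "F ` (orbit \<times> range height) = orbit \<times> range height"
  proof
    show "F ` (orbit \<times> range height) \<subseteq> orbit \<times> range height"
    proof (rule image_subsetI)
      fix z assume "z \<in> orbit \<times> range height"
      then obtain x t where x: "x \<in> orbit" "z = (x, height t)" by auto
      then have "F z = (contraction (t 0) x, height (\<lambda>i. t (Suc i)))"
        using F_height orbit_subset by auto
      then show "F z \<in> orbit \<times> range height" using contraction_orbit[OF x(1)] by simp
    qed
    show "orbit \<times> range height \<subseteq> F ` (orbit \<times> range height)"
    proof
      fix z assume "z \<in> orbit \<times> range height"
      then obtain x t where x: "x \<in> orbit" "z = (x, height t)" by auto
      from x(1) obtain s y where y: "y \<in> orbit" "x = contraction s y" by (rule orbit_preimage)
      have "F (y, height (case_nat s t)) = z"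
        using F_height[of y "case_nat s t"] orbit_subset x y by auto
      then show "z \<in> F ` (orbit \<times> range height)" using y(1) by (intro image_eqI[of _ _ "(y, height (case_nat s t))"]) auto
    qed
  qed
qed

text \<open>The point \<open>(base, height t)\<close> works: after \<open>i\<close> steps its height
  is that of the \<open>i\<close>-fold shift of \<open>t\<close>, which lies in the strip of
  \<open>t i\<close>.\<close>

lemma coding_realize: "\<exists>z\<in>\<Lambda>. \<forall>i. coding ((F ^^ i) z) = t i"
proof -
  have "base \<in> orbit" unfolding orbit_def by (metis foldr.simps(1) id_apply rangeI)
  have iter: "\<exists>x\<in>orbit. (F ^^ i) (base, height t) = (x, height (\<lambda>j. t (i + j)))" for i
  proof (induction i)
    case 0
    show ?case using \<open>base \<in> orbit\<close> by auto
  next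
    case (Suc i)
    then obtain x where x: "x \<in> orbit" "(F ^^ i) (base, height t) = (x, height (\<lambda>j. t (i + j)))" by blast
    then have "(F ^^ Suc i) (base, height t) = (contraction (t i) x, height (\<lambda>j. t (Suc i + j)))"
      using F_height[of x "\<lambda>j. t (i + j)"] orbit_subset by auto
    then show ?case using contraction_orbit[OF x(1)] by blast
  qed
  have mem: "(base, height t) \<in> \<Lambda>" using orbit_heights_subset \<open>base \<in> orbit\<close> by blast
  have "coding ((F ^^ i) (base, height t)) = t i" for i
  proof -
    obtain x where x: "x \<in> orbit" "(F ^^ i) (base, height t) = (x, height (\<lambda>j. t (i + j)))"
      using iter by blast
    have "(F ^^ i) (base, height t) \<in> strip (t i)"
      unfolding x(2) using x(1) orbit_subset height_in_strip[of "\<lambda>j. t (i + j)"] by (auto simp: strip_def)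
    then show ?thesis
      using in_strip[OF iterate_mem[OF mem], of i "t i"] by simp
  qed
  with mem show ?thesis by blast
qed

sublocale binary_coding \<Lambda> F coding
proof
  show "compact \<Lambda>"
    by (intro compact_maximal_invariant_set continuous_F compact_Times compact_Icc)
  show "continuous_on \<Lambda> F" using continuous_F maximal_invariant_set_subset by (rule continuous_on_subset)
  show "F ` \<Lambda> = \<Lambda>" by (rule maximal_invariant_set_image)
  show "openin (top_of_set \<Lambda>) {z \<in> \<Lambda>. coding z = s}" for s
  proof -
    have "{z \<in> \<Lambda>. coding z = s} = \<Lambda> \<inter> - strip (\<not> s)" using in_strip[of _ "\<not> s"] by auto
    moreover have "closed (strip (\<not> s))" unfolding strip_def by (intro closed_Times closed_atLeastAtMost)
    ultimately show ?thesis by (simp add: openin_open_Int open_Compl)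
  qed
qed (rule coding_expansive coding_realize, assumption?)+

end

section \<open>From the horseshoe to its affine branches, and the theorem\<close>

lemma smale_horseshoe_affine:
  assumes "smale_horseshoe F"
  obtains a b c d l m p q where "affine_horseshoe F a b c d l m p q"
proof -
  obtain U where U: "unit_square \<subseteq> U" "open U" "C1_embedding_on U F"
    using assms by (auto simp: smale_horseshoe_def)
  obtain a0 b0 a1 b1 c0 d0 c1 d1 where S: "c0 < d0" "c1 < d1"
    "{a0..b0} \<subseteq> {0..1}" "{a1..b1} \<subseteq> {0..1}" "{c0..d0} \<inter> {c1..d1} = {}"
    "affine_hyperbolic_strip F {a0..b0} {c0..d0}" "affine_hyperbolic_strip F {a1..b1} {c1..d1}"
    "unit_square \<inter> F ` unit_square = {c0..d0} \<times> {0..1} \<union> {c1..d1} \<times> {0..1}"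
    using assms unfolding smale_horseshoe_def by (elim conjE exE) (rule that)
  obtain l0 m0 p0 q0 where S0: "F ` ({0..1} \<times> {a0..b0}) = {c0..d0} \<times> {0..1}" "\<bar>l0\<bar> < 1" "1 < \<bar>m0\<bar>"
    "\<And>x y. x \<in> {0..1} \<Longrightarrow> y \<in> {a0..b0} \<Longrightarrow> F (x, y) = (p0 + l0 * x, q0 + m0 * y)"
    using S(6) unfolding affine_hyperbolic_strip_def by (elim conjE exE) (rule that, simp_all)
  obtain l1 m1 p1 q1 where S1: "F ` ({0..1} \<times> {a1..b1}) = {c1..d1} \<times> {0..1}" "\<bar>l1\<bar> < 1" "1 < \<bar>m1\<bar>"
    "\<And>x y. x \<in> {0..1} \<Longrightarrow> y \<in> {a1..b1} \<Longrightarrow> F (x, y) = (p1 + l1 * x, q1 + m1 * y)"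
    using S(7) unfolding affine_hyperbolic_strip_def by (elim conjE exE) (rule that, simp_all)
  have "affine_horseshoe F (case_bool a0 a1) (case_bool b0 b1) (case_bool c0 c1) (case_bool d0 d1)
    (case_bool l0 l1) (case_bool m0 m1) (case_bool p0 p1) (case_bool q0 q1)"
  proof
    have "continuous_on U F"
      using U(3) unfolding C1_embedding_on_def
      by (meson continuous_at_imp_continuous_on has_derivative_continuous)
    then show "continuous_on unit_square F" using U(1) by (rule continuous_on_subset)
    show "inj_on F unit_square" using U inj_on_subset by (auto simp: C1_embedding_on_def)
    show "unit_square \<inter> F ` unit_square = (\<Union>s. {case_bool c0 c1 s..case_bool d0 d1 s} \<times> {0..1})"
      unfolding S(8) by (auto simp: UNIV_bool)
    fix s
    show "case_bool c0 c1 s < case_bool d0 d1 s" by (cases s) (simp_all only: bool.case S)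
    show "{case_bool a0 a1 s..case_bool b0 b1 s} \<subseteq> {0..1}" by (cases s) (simp_all only: bool.case S)
    show "F ` ({0..1} \<times> {case_bool a0 a1 s..case_bool b0 b1 s}) =
        {case_bool c0 c1 s..case_bool d0 d1 s} \<times> {0..1}"
      by (cases s) (simp_all only: bool.case S0 S1)
    show "\<bar>case_bool l0 l1 s\<bar> < 1" "1 < \<bar>case_bool m0 m1 s\<bar>"
      by (cases s; simp only: bool.case S0 S1)+
    fix x y :: real assume "x \<in> {0..1}" "y \<in> {case_bool a0 a1 s..case_bool b0 b1 s}"
    then show "F (x, y) = (case_bool p0 p1 s + case_bool l0 l1 s * x, case_bool q0 q1 s + case_bool m0 m1 s * y)"
      by (cases s) (simp_all only: bool.case S0 S1)
  qed (simp only: bool.case S(5))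
  then show ?thesis by (rule that)
qed

theorem corollary1p2:
  fixes f :: "real \<times> real \<Rightarrow> real \<times> real" and \<Lambda> :: "(real \<times> real) set"
  assumes "smale_horseshoe f"
    and "\<Lambda> = maximal_invariant_set f unit_square"
  shows "\<exists>\<N> :: (real \<times> real) set set.
    uncountable \<N> \<and>
    (\<forall>N\<in>\<N>. N \<in> sets (restrict_space borel \<Lambda>)) \<and>
    (\<exists>\<phi> :: real \<times> real \<Rightarrow> real. continuous_on \<Lambda> \<phi> \<and> (\<forall>N\<in>\<N>. N \<subseteq> irregular_set f \<Lambda> \<phi>)) \<and>
    (\<forall>N\<in>\<N>. \<Lambda> \<subseteq> closure N \<and> f ` N \<subseteq> N) \<and>
    (\<forall>N\<in>\<N>. \<forall>N'\<in>\<N>. N \<noteq> N' \<longrightarrow> N \<inter> N' = {}) \<and>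
    (\<forall>N\<in>\<N>. subset_entropy f \<Lambda> N = topological_entropy f \<Lambda>)"
proof -
  obtain a b c d l m p q where "affine_horseshoe f a b c d l m p q"
    using smale_horseshoe_affine[OF assms(1)] .
  then interpret affine_horseshoe f a b c d l m p q .
  show ?thesis unfolding assms(2) by (rule exists_disjoint_irregular_family)
qed

end
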